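(* For every infinite cardinal $\kappa$ there exists a unique, up to isomorphism, algebraically closed field of characteristic zero and cardinality $\kappa_+$. Consequently, the field $\mathbb{C}_\kappa$ of $\kappa$-complex numbers exists for every infinite cardinal $\kappa$.
   Context: The set-theoretical framework is ZFC together with the Generalized Continuum Hypothesis, $2^\kappa=\kappa_+$ for all infinite cardinals $\kappa$, where $\kappa_+$ denotes the successor cardinal of $\kappa$. For an infinite cardinal $\kappa$, a field of $\kappa$-complex numbers $\mathbb{C}_\kappa$ is, by definition, an algebraically closed field of characteristic zero and cardinality $\kappa_+$. *)

theory Defs
  imports "HOL-Algebra.Algebra"
begin

unbundle cardinal_syntax

text \<open>
  Cardinals are represented, as in the HOL library, by cardinal orders \<open>\<kappa> :: 'k rel\<close> on a subset
  of an arbitrary type \<open>'k\<close>; the successor \<open>\<kappa>\<^sub>+\<close> is \<^const>\<open>cardSuc\<close>, a relation on \<open>'k set\<close>.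
  HOL cannot quantify over all types inside a formula, so \<open>GCH TYPE('k)\<close> states the Generalized
  Continuum Hypothesis for the cardinals carried by \<open>'k\<close>.
\<close>

definition GCH :: "'k itself \<Rightarrow> bool" where
  "GCH _ \<longleftrightarrow> (\<forall>\<kappa> :: 'k rel. Cinfinite \<kappa> \<longrightarrow> ctwo ^c \<kappa> =o cardSuc \<kappa>)"

definition characteristic_zero :: "('a, 'm) ring_scheme \<Rightarrow> bool" where
  "characteristic_zero R \<longleftrightarrow> (\<forall>n :: nat. n > 0 \<longrightarrow> [n] \<cdot>\<^bsub>R\<^esub> \<one>\<^bsub>R\<^esub> \<noteq> \<zero>\<^bsub>R\<^esub>)"

definition kappa_complex_field :: "'k rel \<Rightarrow> ('a, 'm) ring_scheme \<Rightarrow> bool" where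
  "kappa_complex_field \<kappa> F \<longleftrightarrow>
     algebraically_closed F \<and> characteristic_zero F \<and> |carrier F| =o cardSuc \<kappa>"

end

theory Submission
  imports "HOL-Library.Countable" "HOL-Computational_Algebra.Fundamental_Theorem_Algebra" Defs
begin

text \<open>
  Existence. Instead of closing up a field of rational functions, a large field is cut out of a ring
  of functions. Take all functions from the finite subsets of \<open>\<kappa>\<close> to the complex numbers,
  identify two of them when they agree on all finite sets above some finite set, and pass to the
  quotient by a maximal ideal. The quotient is algebraically closed because a monic polynomial lifts
  to a family of monic complex polynomials, whose roots can be chosen one index at a time
  (\<open>algebraically_closed_image_function_ring\<close>). It has \<open>2^\<kappa>\<close> elements: at most that many, because
  there are \<open>(2^\<omega>)^\<kappa> = 2^\<kappa>\<close> functions, and at least that many, because every subset \<open>B\<close> of \<open>\<kappa>\<close>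
  yields the function that sends \<open>t\<close> to a code of \<open>B \<inter> t\<close>, and the difference of two such
  functions is invertible from some finite set on (\<open>algebraically_closed_field_exists\<close>). The
  Generalized Continuum Hypothesis identifies \<open>2^\<kappa>\<close> with \<open>\<kappa>\<^sub>+\<close>.

  Uniqueness is the theorem of Steinitz. Write \<open>acl A\<close> for the least relatively algebraically closed
  subring that contains \<open>A\<close>. Well-order a field \<open>F\<close> of cardinality \<open>\<kappa>\<^sub>+\<close> in its initial order type and
  keep those elements that do not lie in the \<open>acl\<close> of their predecessors. The elements that are kept
  span \<open>F\<close> (\<open>acl_base_spans\<close>), and there are \<open>\<kappa>\<^sub>+\<close> of them, since \<open>acl\<close> does not lead from a set of at
  most \<open>\<kappa>\<close> elements to a bigger one (\<open>card_acl\<close>). A subset of full cardinality of an initial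
  order type has that order type again, so the bases of two such fields are order isomorphic.
  It remains to extend this order isomorphism to the fields (\<open>isomorphic_if_acl_bases\<close>).

  The extension is one application of Zorn's lemma. An isomorphism between subrings of \<open>F\<close> and \<open>G\<close> is
  viewed as a subring \<open>R\<close> of \<open>F \<times> G\<close> in which a component vanishes only together with the other
  one. Polynomials over the domain \<open>R\<close> can be evaluated at some \<open>x\<close> in \<open>F\<close> and at some \<open>y\<close> in \<open>G\<close>, and
  if both evaluations have the same kernel then their joint image is a larger isomorphism
  (\<open>simple_extension_exists\<close>). For algebraic \<open>x\<close> a suitable \<open>y\<close> is a root of a minimal polynomial of
  \<open>x\<close> (\<open>conjugate_exists\<close>). For corresponding base elements that are both transcendental the two
  kernels are zero. A maximal isomorphism therefore has relatively closed domain and range that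
  contain the two bases, so it is total and onto.
\<close>

section \<open>Polynomial sums and their roots\<close>

text \<open>
  Coefficients are given by a function rather than by a list, so that a homomorphism acts on them by
  composition and a sequence of pairs splits into two sequences by projection.
\<close>

definition psum :: "('a, 'm) ring_scheme \<Rightarrow> nat \<Rightarrow> (nat \<Rightarrow> 'a) \<Rightarrow> 'a \<Rightarrow> 'a" where
  "psum F n c x = (\<Oplus>\<^bsub>F\<^esub>i\<in>{..n}. c i \<otimes>\<^bsub>F\<^esub> x [^]\<^bsub>F\<^esub> i)"

text \<open>
  This is the link to the list polynomials in which algebraic closedness is formulated; there the
  leading coefficient comes first, hence the reversal.
\<close>

lemma (in cring) eval_map_rev_upt:
  assumes "\<And>i. i \<le> n \<Longrightarrow> c i \<in> carrier R" "x \<in> carrier R"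
  shows "eval (map c (rev [0..<Suc n])) x = psum R n c x"
  using assms(1)
proof (induction n)
  case 0
  then show ?case using assms(2) by (simp add: psum_def)
next
  case (Suc n)
  have *: "map c (rev [0..<Suc (Suc n)]) = c (Suc n) # map c (rev [0..<Suc n])"
    by simp
  have "eval (map c (rev [0..<Suc (Suc n)])) x
      = c (Suc n) \<otimes> x [^] Suc n \<oplus> eval (map c (rev [0..<Suc n])) x"
    unfolding * eval.simps by simp
  also have "\<dots> = psum R (Suc n) c x"
    using Suc assms(2) by (simp add: psum_def Pi_def a_comm)
  finally show ?case .
qed

lemma (in cring) map_rev_upt_in_poly_ring:
  assumes "\<And>i. i \<le> n \<Longrightarrow> c i \<in> carrier R" "c n \<noteq> \<zero>"
  shows "map c (rev [0..<Suc n]) \<in> carrier (poly_ring R)"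
  using assms by (auto simp: univ_poly_carrier[symmetric] polynomial_def)

lemma (in cring) poly_ring_as_map:
  assumes "p \<in> carrier (poly_ring R)" "degree p = n" "0 < n"
  obtains c where "\<And>i. i \<le> n \<Longrightarrow> c i \<in> carrier R" "c n \<noteq> \<zero>" "p = map c (rev [0..<Suc n])"
proof
  let ?c = "\<lambda>i. p ! (n - i)"
  have len: "length p = Suc n" using assms by linarith
  have set: "set p \<subseteq> carrier R" "p \<noteq> [] \<Longrightarrow> lead_coeff p \<noteq> \<zero>"
    using assms(1) by (auto simp: univ_poly_carrier[symmetric] polynomial_def)
  show "?c i \<in> carrier R" if "i \<le> n" for i
    using set(1) len nth_mem[of "n - i" p] by auto
  show "?c n \<noteq> \<zero>" using set(2) len by (simp add: hd_conv_nth[symmetric] length_0_conv[symmetric] del: length_0_conv)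
  show "p = map ?c (rev [0..<Suc n])"
    using len by (intro nth_equalityI) (auto simp: rev_nth simp del: upt_Suc)
qed

lemma algebraically_closed_psum_root:
  assumes "algebraically_closed F" "0 < n" "\<And>i. i \<le> n \<Longrightarrow> c i \<in> carrier F" "c n \<noteq> \<zero>\<^bsub>F\<^esub>"
  shows "\<exists>y\<in>carrier F. psum F n c y = \<zero>\<^bsub>F\<^esub>"
proof -
  interpret algebraically_closed F by fact
  let ?p = "map c (rev [0..<Suc n])"
  have p: "?p \<in> carrier (poly_ring F)" by (rule map_rev_upt_in_poly_ring) (use assms in auto)
  then have "size (roots ?p) = n" using roots_over_carrier[OF p] by (simp add: splitted_def)
  then obtain y where "y \<in># roots ?p" using assms(2) by (metis neq0_conv size_empty multiset_nonemptyE)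
  then have "is_root ?p y" using roots_mem_iff_is_root[OF p] by simp
  then show ?thesis using eval_map_rev_upt[of n c y] assms(3) unfolding is_root_def by auto
qed

lemma (in field) algebraically_closed_if_psum_roots:
  assumes "\<And>n c. \<lbrakk>0 < n; \<And>i. i \<le> n \<Longrightarrow> c i \<in> carrier R; c n \<noteq> \<zero>\<rbrakk> \<Longrightarrow> \<exists>y\<in>carrier R. psum R n c y = \<zero>"
  shows "algebraically_closed R"
proof (rule algebraically_closedI)
  fix p assume p: "p \<in> carrier (poly_ring R)" "1 < degree p"
  from p(2) have "0 < degree p" by simp
  then obtain c where c: "\<And>i. i \<le> degree p \<Longrightarrow> c i \<in> carrier R" "c (degree p) \<noteq> \<zero>"
      "p = map c (rev [0..<Suc (degree p)])"
    using poly_ring_as_map[OF p(1) refl] by blast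
  have "\<exists>y\<in>carrier R. psum R (degree p) c y = \<zero>"
    by (rule assms) (use c(1,2) \<open>0 < degree p\<close> in auto)
  then obtain y where y: "y \<in> carrier R" "psum R (degree p) c y = \<zero>" by blast
  then have "eval (map c (rev [0..<Suc (degree p)])) y = \<zero>"
    using eval_map_rev_upt[of "degree p" c y] c(1) by metis
  then have "eval p y = \<zero>" using c(3) by metis
  then show "\<exists>x\<in>carrier R. eval p x = \<zero>" using y by blast
qed

lemma (in domain) finite_psum_roots:
  assumes "\<And>i. i \<le> n \<Longrightarrow> c i \<in> carrier R" "c n \<noteq> \<zero>"
  shows "finite {x \<in> carrier R. psum R n c x = \<zero>}"
proof -
  let ?p = "map c (rev [0..<Suc n])"
  have p: "?p \<in> carrier (poly_ring R)" by (rule map_rev_upt_in_poly_ring) (use assms in auto)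
  have "{x \<in> carrier R. psum R n c x = \<zero>} \<subseteq> set_mset (roots ?p)"
  proof clarify
    fix x assume "x \<in> carrier R" "psum R n c x = \<zero>"
    then have "is_root ?p x" using eval_map_rev_upt[of n c x] assms(1) by (simp add: is_root_def)
    then show "x \<in># roots ?p" using roots_mem_iff_is_root[OF p] by simp
  qed
  then show ?thesis using finite_subset by blast
qed

section \<open>Relatively algebraically closed subrings\<close>

text \<open>
  Subrings suffice, since a relatively closed subring of a field is a subfield: the inverse of \<open>a\<close>
  is a root of \<open>a X - 1\<close>. The leading coefficient must be nonzero, for otherwise every element would
  be a root of the zero polynomial.
\<close>

definition relatively_closed :: "('a, 'm) ring_scheme \<Rightarrow> 'a set \<Rightarrow> bool" where
  "relatively_closed F K \<longleftrightarrow> subring K F \<and>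
     (\<forall>n c x. (\<forall>i\<le>n. c i \<in> K) \<and> c n \<noteq> \<zero>\<^bsub>F\<^esub> \<and> x \<in> carrier F \<and> psum F n c x = \<zero>\<^bsub>F\<^esub> \<longrightarrow> x \<in> K)"

text \<open>
  Defining the closure as an intersection makes it idempotent for trivial reasons. With the set of
  elements algebraic over a generated subfield, idempotence would need the tower law for algebraic
  extensions.
\<close>

definition acl :: "('a, 'm) ring_scheme \<Rightarrow> 'a set \<Rightarrow> 'a set" where
  "acl F A = \<Inter>{K. relatively_closed F K \<and> A \<subseteq> K}"

lemma relatively_closedD:
  assumes "relatively_closed F K" "\<And>i. i \<le> n \<Longrightarrow> c i \<in> K" "c n \<noteq> \<zero>\<^bsub>F\<^esub>"
    "x \<in> carrier F" "psum F n c x = \<zero>\<^bsub>F\<^esub>"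
  shows "x \<in> K"
  using assms unfolding relatively_closed_def by blast

lemma (in ring) relatively_closed_carrier: "relatively_closed R (carrier R)"
  by (simp add: relatively_closed_def carrier_is_subring)

lemma acl_extensive: "A \<subseteq> acl F A"
  by (auto simp: acl_def)

lemma acl_mono: "A \<subseteq> B \<Longrightarrow> acl F A \<subseteq> acl F B"
  by (auto simp: acl_def)

lemma acl_least: "relatively_closed F K \<Longrightarrow> A \<subseteq> K \<Longrightarrow> acl F A \<subseteq> K"
  by (auto simp: acl_def)

lemma (in ring) relatively_closed_acl:
  assumes "A \<subseteq> carrier R"
  shows "relatively_closed R (acl R A)"
  unfolding relatively_closed_def
proof (intro conjI allI impI)
  let ?C = "{K. relatively_closed R K \<and> A \<subseteq> K}"
  have ne: "carrier R \<in> ?C" using assms relatively_closed_carrier by simp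
  have sr: "subring K R" if "K \<in> ?C" for K using that by (simp add: relatively_closed_def)
  show "subring (acl R A) R"
    unfolding acl_def
    by (rule subringI) (use ne sr in \<open>auto dest: subringE\<close>)
next
  fix n c x
  assume "(\<forall>i\<le>n. c i \<in> acl R A) \<and> c n \<noteq> \<zero> \<and> x \<in> carrier R \<and> psum R n c x = \<zero>"
  then show "x \<in> acl R A"
    unfolding acl_def using relatively_closedD[of R _ n c x] by blast
qed

section \<open>Partial isomorphisms\<close>

text \<open>
  The operations on pairs are unfolded through projections, so that the equations also rewrite sums
  and products of pairs that are not given by their components.
\<close>

lemma RDirProd_simps:
  "carrier (RDirProd F G) = carrier F \<times> carrier G"
  "\<one>\<^bsub>RDirProd F G\<^esub> = (\<one>\<^bsub>F\<^esub>, \<one>\<^bsub>G\<^esub>)"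
  "\<zero>\<^bsub>RDirProd F G\<^esub> = (\<zero>\<^bsub>F\<^esub>, \<zero>\<^bsub>G\<^esub>)"
  "a \<oplus>\<^bsub>RDirProd F G\<^esub> b = (fst a \<oplus>\<^bsub>F\<^esub> fst b, snd a \<oplus>\<^bsub>G\<^esub> snd b)"
  "a \<otimes>\<^bsub>RDirProd F G\<^esub> b = (fst a \<otimes>\<^bsub>F\<^esub> fst b, snd a \<otimes>\<^bsub>G\<^esub> snd b)"
  by (cases a; cases b; simp add: RDirProd_def DirProd_def monoid.defs)+

text \<open>
  The graph of an isomorphism between a subring of \<open>F\<close> and a subring of \<open>G\<close>: both projections of \<open>R\<close>
  are injective because their kernels vanish. Graphs treat the two fields symmetrically, and unions of
  chains of them are again graphs of this kind.
\<close>

locale partial_iso = F: field F + G: field G for F (structure) and G (structure) +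
  fixes R :: "('a \<times> 'c) set"
  assumes subring: "subring R (RDirProd F G)"
    and zero_iff: "(a, b) \<in> R \<Longrightarrow> a = \<zero>\<^bsub>F\<^esub> \<longleftrightarrow> b = \<zero>\<^bsub>G\<^esub>"
begin

lemma ring_RDirProd: "ring (RDirProd F G)"
  by (rule RDirProd_ring) (unfold_locales)

lemma uminus_RDirProd: "a \<in> carrier F \<Longrightarrow> b \<in> carrier G \<Longrightarrow> \<ominus>\<^bsub>RDirProd F G\<^esub> (a, b) = (\<ominus>\<^bsub>F\<^esub> a, \<ominus>\<^bsub>G\<^esub> b)"
  by (intro abelian_group.minus_equality[OF ring.is_abelian_group[OF ring_RDirProd]])
     (simp_all add: RDirProd_simps F.l_neg G.l_neg)

lemma in_carrier: "(a, b) \<in> R \<Longrightarrow> a \<in> carrier F \<and> b \<in> carrier G"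
  using subringE(1)[OF subring] by (auto simp: RDirProd_simps)

lemma one_mem: "(\<one>\<^bsub>F\<^esub>, \<one>\<^bsub>G\<^esub>) \<in> R"
  using subringE(3)[OF subring] by (simp add: RDirProd_simps)

lemma uminus_mem: "(a, b) \<in> R \<Longrightarrow> (\<ominus>\<^bsub>F\<^esub> a, \<ominus>\<^bsub>G\<^esub> b) \<in> R"
  using subringE(5)[OF subring, of "(a,b)"] in_carrier[of a b] by (simp add: uminus_RDirProd)

lemma mult_mem: "(a, b) \<in> R \<Longrightarrow> (c, d) \<in> R \<Longrightarrow> (a \<otimes>\<^bsub>F\<^esub> c, b \<otimes>\<^bsub>G\<^esub> d) \<in> R"
  using subringE(6)[OF subring, of "(a,b)" "(c,d)"] by (simp add: RDirProd_simps)

lemma add_mem: "(a, b) \<in> R \<Longrightarrow> (c, d) \<in> R \<Longrightarrow> (a \<oplus>\<^bsub>F\<^esub> c, b \<oplus>\<^bsub>G\<^esub> d) \<in> R"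
  using subringE(7)[OF subring, of "(a,b)" "(c,d)"] by (simp add: RDirProd_simps)

end

lemma partial_isoI:
  assumes "field F" "field G" "R \<subseteq> carrier F \<times> carrier G"
    "(\<one>\<^bsub>F\<^esub>, \<one>\<^bsub>G\<^esub>) \<in> R"
    "\<And>a b. (a, b) \<in> R \<Longrightarrow> (\<ominus>\<^bsub>F\<^esub> a, \<ominus>\<^bsub>G\<^esub> b) \<in> R"
    "\<And>a b c d. (a, b) \<in> R \<Longrightarrow> (c, d) \<in> R \<Longrightarrow> (a \<otimes>\<^bsub>F\<^esub> c, b \<otimes>\<^bsub>G\<^esub> d) \<in> R"
    "\<And>a b c d. (a, b) \<in> R \<Longrightarrow> (c, d) \<in> R \<Longrightarrow> (a \<oplus>\<^bsub>F\<^esub> c, b \<oplus>\<^bsub>G\<^esub> d) \<in> R"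
    "\<And>a b. (a, b) \<in> R \<Longrightarrow> a = \<zero>\<^bsub>F\<^esub> \<longleftrightarrow> b = \<zero>\<^bsub>G\<^esub>"
  shows "partial_iso F G R"
proof -
  interpret F: field F by fact
  interpret G: field G by fact
  interpret D: ring "RDirProd F G" by (rule RDirProd_ring) (unfold_locales)
  have u: "\<ominus>\<^bsub>RDirProd F G\<^esub> (a, b) = (\<ominus>\<^bsub>F\<^esub> a, \<ominus>\<^bsub>G\<^esub> b)" if "a \<in> carrier F" "b \<in> carrier G" for a b
    by (intro D.minus_equality)
     (simp_all add: RDirProd_simps F.l_neg G.l_neg that)
  show ?thesis
  proof (intro partial_iso.intro partial_iso_axioms.intro assms(1,2))
    show "subring R (RDirProd F G)"
    proof (rule D.subringI)
      fix h assume "h \<in> R"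
      then show "\<ominus>\<^bsub>RDirProd F G\<^esub> h \<in> R" using assms(3,5) by (cases h) (auto simp: u)
    qed (use assms in \<open>auto simp: RDirProd_simps\<close>)
  qed (use assms in auto)
qed

lemma partial_iso_converse:
  assumes "partial_iso F G R"
  shows "partial_iso G F (R\<inverse>)"
proof -
  interpret partial_iso F G R by fact
  show ?thesis
    by (rule partial_isoI)
       (auto simp: in_carrier one_mem uminus_mem mult_mem add_mem zero_iff intro: F.field_axioms G.field_axioms)
qed

context partial_iso
begin

text \<open>
  Polynomials over this ring are polynomials over the domain of the isomorphism together with
  their images; the two projections recover both.
\<close>

abbreviation "pair_ring \<equiv> (RDirProd F G)\<lparr>carrier := R\<rparr>"

text \<open>
  The product of two fields has zero divisors, but they have exactly one vanishing component and so
  do not occur in \<open>R\<close>.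
\<close>

lemma domain_pair_ring: "domain pair_ring"
proof (rule domainI)
  interpret D: ring "RDirProd F G" by (rule ring_RDirProd)
  have "subcring R (RDirProd F G)"
    using subring by (rule D.subcringI) (auto simp: RDirProd_simps dest!: in_carrier intro: F.m_comm G.m_comm)
  then show "cring pair_ring" by (rule D.subcring_iff[THEN iffD1, rotated]) (use subringE(1)[OF subring] in simp)
  show "\<one>\<^bsub>pair_ring\<^esub> \<noteq> \<zero>\<^bsub>pair_ring\<^esub>" by (simp add: RDirProd_simps)
  show "a = \<zero>\<^bsub>pair_ring\<^esub> \<or> b = \<zero>\<^bsub>pair_ring\<^esub>" if "a \<otimes>\<^bsub>pair_ring\<^esub> b = \<zero>\<^bsub>pair_ring\<^esub>" "a \<in> carrier pair_ring" "b \<in> carrier pair_ring" for a b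
    using that in_carrier zero_iff
    by (cases a; cases b) (simp add: RDirProd_simps, metis F.integral_iff)
qed

lemma fst_hom: "UP_pre_univ_prop pair_ring F fst"
proof -
  interpret S: domain pair_ring by (rule domain_pair_ring)
  show ?thesis
    by (rule UP_pre_univ_propI)
       (auto intro!: ring_hom_memI S.is_cring F.is_cring simp: RDirProd_simps dest: in_carrier)
qed

lemma snd_hom: "UP_pre_univ_prop pair_ring G snd"
proof -
  interpret S: domain pair_ring by (rule domain_pair_ring)
  show ?thesis
    by (rule UP_pre_univ_propI)
       (auto intro!: ring_hom_memI S.is_cring G.is_cring simp: RDirProd_simps dest: in_carrier)
qed

end

section \<open>Adjoining one pair of elements\<close>

lemma (in cring) psum_in_subring:
  assumes "subring K R" "\<And>i. i \<le> n \<Longrightarrow> c i \<in> K" "x \<in> K"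
  shows "psum R n c x \<in> K"
  using assms(2)
proof (induction n)
  have sub: "K \<subseteq> carrier R" by (rule subringE(1)[OF assms(1)])
  have pow: "x [^] (k::nat) \<in> K" for k
    by (induction k) (simp_all add: subringE(3,6)[OF assms(1)] assms(3))
  have car: "c i \<otimes> x [^] (k::nat) \<in> K" if "c i \<in> K" for i k
    by (intro subringE(6)[OF assms(1)] pow that)
  { case 0
    then have "psum R 0 c x = c 0 \<otimes> x [^] (0::nat)"
      unfolding psum_def using subsetD[OF sub car[of 0 0]] by simp
    then show ?case using car[of 0 0] 0 by simp
  next
    case (Suc n)
    have "psum R (Suc n) c x = c (Suc n) \<otimes> x [^] Suc n \<oplus> psum R n c x"
      unfolding psum_def using Suc.prems subsetD[OF sub car] by (simp add: Pi_def del: nat_pow_Suc)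
    then show ?case
      using subringE(7)[OF assms(1) car[of "Suc n" "Suc n"] Suc.IH] Suc.prems by simp }
qed

lemma (in domain) nat_pow_nonzero:
  "x \<in> carrier R \<Longrightarrow> x \<noteq> \<zero> \<Longrightarrow> x [^] (n::nat) \<noteq> \<zero>"
  by (induction n) (auto simp: integral_iff)

text \<open>
  Over a domain, a nonzero element of least degree generates the kernel of an evaluation up to powers
  of its leading coefficient: the remainder of a pseudo-division lies in the kernel and has smaller
  degree. The criterion on the right does not mention \<open>\<phi>\<close>. Hence two homomorphisms whose kernels have
  a common element that is of least degree in both have equal kernels.
\<close>

lemma (in UP_domain) kernel_iff_pseudo_divides:
  assumes "ring_hom_cring P A \<phi>" "domain A"
    and const: "\<And>c. c \<in> carrier R \<Longrightarrow> c \<noteq> \<zero> \<Longrightarrow> \<phi> (up_ring.monom P c 0) \<noteq> \<zero>\<^bsub>A\<^esub>"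
    and p: "p \<in> carrier P" "p \<noteq> \<zero>\<^bsub>P\<^esub>" "\<phi> p = \<zero>\<^bsub>A\<^esub>"
    and minimal: "\<And>q. q \<in> carrier P \<Longrightarrow> q \<noteq> \<zero>\<^bsub>P\<^esub> \<Longrightarrow> \<phi> q = \<zero>\<^bsub>A\<^esub> \<Longrightarrow> deg R p \<le> deg R q"
    and q: "q \<in> carrier P"
  shows "\<phi> q = \<zero>\<^bsub>A\<^esub> \<longleftrightarrow> (\<exists>(k::nat) s. s \<in> carrier P \<and> lcoeff p [^] k \<odot>\<^bsub>P\<^esub> q = p \<otimes>\<^bsub>P\<^esub> s)"
proof -
  interpret h: ring_hom_cring P A \<phi> by fact
  interpret A: domain A by fact
  have lc: "lcoeff p [^] (k::nat) \<in> carrier R" "\<phi> (up_ring.monom P (lcoeff p [^] k) 0) \<noteq> \<zero>\<^bsub>A\<^esub>" for k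
  proof -
    show "lcoeff p [^] k \<in> carrier R" using p by simp
    moreover have "lcoeff p [^] k \<noteq> \<zero>"
      using lcoeff_nonzero2[OF p(1,2)] p(1) R.nat_pow_nonzero by simp
    ultimately show "\<phi> (up_ring.monom P (lcoeff p [^] k) 0) \<noteq> \<zero>\<^bsub>A\<^esub>" by (rule const)
  qed
  have smult: "\<phi> (lcoeff p [^] (k::nat) \<odot>\<^bsub>P\<^esub> f) = \<phi> (up_ring.monom P (lcoeff p [^] k) 0) \<otimes>\<^bsub>A\<^esub> \<phi> f"
    if "f \<in> carrier P" for k f
    using that lc(1)[of k] by (simp add: monom_mult_is_smult[symmetric])
  show ?thesis
  proof
    assume q0: "\<phi> q = \<zero>\<^bsub>A\<^esub>"
    obtain s r and k :: nat where qr: "s \<in> carrier P" "r \<in> carrier P"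
        "lcoeff p [^] k \<odot>\<^bsub>P\<^esub> q = p \<otimes>\<^bsub>P\<^esub> s \<oplus>\<^bsub>P\<^esub> r" "r = \<zero>\<^bsub>P\<^esub> \<or> deg R r < deg R p"
      using long_div_theorem[OF p(1) q p(2)] by blast
    have "\<phi> (lcoeff p [^] k \<odot>\<^bsub>P\<^esub> q) = \<zero>\<^bsub>A\<^esub>" using smult[OF q] q0 lc p q by simp
    then have "\<phi> r = \<zero>\<^bsub>A\<^esub>" using qr p by simp
    then have "r = \<zero>\<^bsub>P\<^esub>" using minimal[OF qr(2)] qr(4) by fastforce
    then show "\<exists>(k::nat) s. s \<in> carrier P \<and> lcoeff p [^] k \<odot>\<^bsub>P\<^esub> q = p \<otimes>\<^bsub>P\<^esub> s"
      using qr p by (intro exI[of _ k] exI[of _ s]) simp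
  next
    assume "\<exists>(k::nat) s. s \<in> carrier P \<and> lcoeff p [^] k \<odot>\<^bsub>P\<^esub> q = p \<otimes>\<^bsub>P\<^esub> s"
    then obtain k :: nat and s where s: "s \<in> carrier P" "lcoeff p [^] k \<odot>\<^bsub>P\<^esub> q = p \<otimes>\<^bsub>P\<^esub> s" by blast
    have "\<phi> (up_ring.monom P (lcoeff p [^] k) 0) \<otimes>\<^bsub>A\<^esub> \<phi> q = \<zero>\<^bsub>A\<^esub>"
      using smult[OF q, of k] s p by simp
    then show "\<phi> q = \<zero>\<^bsub>A\<^esub>"
      using A.integral[of "\<phi> (up_ring.monom P (lcoeff p [^] k) 0)" "\<phi> q"] lc[of k] q by simp
  qed
qed

context partial_iso
begin

abbreviation "eval_left x \<equiv> UnivPoly.eval pair_ring F fst x"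
abbreviation "eval_right y \<equiv> UnivPoly.eval pair_ring G snd y"

lemma eval_left_psum: "p \<in> carrier (UP pair_ring) \<Longrightarrow> eval_left x p = psum F (deg pair_ring p) (\<lambda>i. fst (up_ring.coeff (UP pair_ring) p i)) x"
  by (simp add: UnivPoly.eval_def psum_def)

lemma eval_right_psum: "p \<in> carrier (UP pair_ring) \<Longrightarrow> eval_right y p = psum G (deg pair_ring p) (\<lambda>i. snd (up_ring.coeff (UP pair_ring) p i)) y"
  by (simp add: UnivPoly.eval_def psum_def)

lemma UP_domain_pair_ring: "UP_domain pair_ring"
  by (intro UP_domain.intro domain_pair_ring)

lemma eval_left_hom: "x \<in> carrier F \<Longrightarrow> ring_hom_cring (UP pair_ring) F (eval_left x)"
  using UP_pre_univ_prop.eval_ring_hom[OF fst_hom] UP_pre_univ_prop.ring_homD[OF fst_hom] by blast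

lemma eval_right_hom: "y \<in> carrier G \<Longrightarrow> ring_hom_cring (UP pair_ring) G (eval_right y)"
  using UP_pre_univ_prop.eval_ring_hom[OF snd_hom] UP_pre_univ_prop.ring_homD[OF snd_hom] by blast

lemma eval_const:
  assumes "c \<in> R"
  shows "x \<in> carrier F \<Longrightarrow> eval_left x (up_ring.monom (UP pair_ring) c 0) = fst c"
    "y \<in> carrier G \<Longrightarrow> eval_right y (up_ring.monom (UP pair_ring) c 0) = snd c"
  using UP_pre_univ_prop.eval_const[OF fst_hom, of x c] UP_pre_univ_prop.eval_const[OF snd_hom, of y c] assms
  by simp_all

lemma const_nonzero: "c \<in> R \<Longrightarrow> c \<noteq> \<zero>\<^bsub>pair_ring\<^esub> \<Longrightarrow> fst c \<noteq> \<zero>\<^bsub>F\<^esub> \<and> snd c \<noteq> \<zero>\<^bsub>G\<^esub>"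
  using zero_iff[of "fst c" "snd c"] by (cases c) (auto simp: RDirProd_simps)

text \<open>
  The new isomorphism consists of the pairs of values of all polynomials over \<open>R\<close>. Equality of the
  kernels is exactly the condition that one component vanishes only with the other. Its
  components are polynomial expressions in the old components and the new one, hence they stay inside
  every subring that contains these.
\<close>

lemma simple_extension_exists:
  assumes x: "x \<in> carrier F" and y: "y \<in> carrier G"
    and ker: "\<And>p. p \<in> carrier (UP pair_ring) \<Longrightarrow> eval_left x p = \<zero>\<^bsub>F\<^esub> \<longleftrightarrow> eval_right y p = \<zero>\<^bsub>G\<^esub>"
  obtains R' where "partial_iso F G R'" "R \<subseteq> R'" "(x, y) \<in> R'"
    "\<And>K. subring K F \<Longrightarrow> Domain R \<subseteq> K \<Longrightarrow> x \<in> K \<Longrightarrow> Domain R' \<subseteq> K"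
    "\<And>K. subring K G \<Longrightarrow> Range R \<subseteq> K \<Longrightarrow> y \<in> K \<Longrightarrow> Range R' \<subseteq> K"
proof
  interpret P: UP_domain pair_ring "UP pair_ring" by (rule UP_domain_pair_ring) 
  interpret e1: ring_hom_cring "UP pair_ring" F "eval_left x" by (rule eval_left_hom[OF x])
  interpret e2: ring_hom_cring "UP pair_ring" G "eval_right y" by (rule eval_right_hom[OF y])
  define R' where "R' = (\<lambda>p. (eval_left x p, eval_right y p)) ` carrier (UP pair_ring)"
  have R'I: "a = eval_left x p \<Longrightarrow> b = eval_right y p \<Longrightarrow> p \<in> carrier (UP pair_ring) \<Longrightarrow> (a, b) \<in> R'" for a b p
    by (auto simp: R'_def)
  show "partial_iso F G R'"
  proof (rule partial_isoI)
    show "(\<one>\<^bsub>F\<^esub>, \<one>\<^bsub>G\<^esub>) \<in> R'" by (rule R'I[of _ "\<one>\<^bsub>UP pair_ring\<^esub>"]) simp_all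
    show "(\<ominus>\<^bsub>F\<^esub> a, \<ominus>\<^bsub>G\<^esub> b) \<in> R'" if "(a, b) \<in> R'" for a b
    proof -
      obtain p where "p \<in> carrier (UP pair_ring)" "a = eval_left x p" "b = eval_right y p"
        using \<open>(a, b) \<in> R'\<close> by (auto simp: R'_def)
      then show ?thesis by (intro R'I[of _ "\<ominus>\<^bsub>UP pair_ring\<^esub> p"]) simp_all
    qed
    show "(a \<otimes>\<^bsub>F\<^esub> c, b \<otimes>\<^bsub>G\<^esub> d) \<in> R'" if "(a, b) \<in> R'" "(c, d) \<in> R'" for a b c d
    proof -
      obtain p q where "p \<in> carrier (UP pair_ring)" "a = eval_left x p" "b = eval_right y p"
          "q \<in> carrier (UP pair_ring)" "c = eval_left x q" "d = eval_right y q"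
        using \<open>(a, b) \<in> R'\<close> \<open>(c, d) \<in> R'\<close> by (auto simp: R'_def)
      then show ?thesis by (intro R'I[of _ "p \<otimes>\<^bsub>UP pair_ring\<^esub> q"]) simp_all
    qed
    show "(a \<oplus>\<^bsub>F\<^esub> c, b \<oplus>\<^bsub>G\<^esub> d) \<in> R'" if "(a, b) \<in> R'" "(c, d) \<in> R'" for a b c d
    proof -
      obtain p q where "p \<in> carrier (UP pair_ring)" "a = eval_left x p" "b = eval_right y p"
          "q \<in> carrier (UP pair_ring)" "c = eval_left x q" "d = eval_right y q"
        using \<open>(a, b) \<in> R'\<close> \<open>(c, d) \<in> R'\<close> by (auto simp: R'_def)
      then show ?thesis by (intro R'I[of _ "p \<oplus>\<^bsub>UP pair_ring\<^esub> q"]) simp_all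
    qed
    show "R' \<subseteq> carrier F \<times> carrier G" by (auto simp: R'_def)
    show "a = \<zero>\<^bsub>F\<^esub> \<longleftrightarrow> b = \<zero>\<^bsub>G\<^esub>" if "(a, b) \<in> R'" for a b
      using that ker by (auto simp: R'_def)
  qed (rule F.field_axioms, rule G.field_axioms)
  show "R \<subseteq> R'"
  proof
    fix c assume c: "c \<in> R"
    then show "c \<in> R'" using R'I[of "fst c" "up_ring.monom (UP pair_ring) c 0" "snd c"] eval_const[OF c] x y by simp
  qed
  show "(x, y) \<in> R'"
    using UP_pre_univ_prop.eval_monom1[OF fst_hom x] UP_pre_univ_prop.eval_monom1[OF snd_hom y]
    by (intro R'I[of _ "up_ring.monom (UP pair_ring) \<one>\<^bsub>pair_ring\<^esub> 1"] P.monom_closed[OF P.R.one_closed]) metis+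
  have co: "up_ring.coeff (UP pair_ring) p i \<in> R" if "p \<in> carrier (UP pair_ring)" for p i
    using P.coeff_closed[OF that] by simp
  show "Domain R' \<subseteq> K" if "subring K F" "Domain R \<subseteq> K" "x \<in> K" for K
  proof -
    have "eval_left x p \<in> K" if p: "p \<in> carrier (UP pair_ring)" for p
      unfolding eval_left_psum[OF p] using co[OF p] \<open>Domain R \<subseteq> K\<close>
      by (intro F.psum_in_subring \<open>subring K F\<close> \<open>x \<in> K\<close>) (metis Domain.DomainI prod.collapse subsetD)
    then show ?thesis by (auto simp: R'_def)
  qed
  show "Range R' \<subseteq> K" if "subring K G" "Range R \<subseteq> K" "y \<in> K" for K
  proof -
    have "eval_right y p \<in> K" if p: "p \<in> carrier (UP pair_ring)" for p
      unfolding eval_right_psum[OF p] using co[OF p] \<open>Range R \<subseteq> K\<close>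
      by (intro G.psum_in_subring \<open>subring K G\<close> \<open>y \<in> K\<close>) (metis Range.intros prod.collapse subsetD)
    then show ?thesis by (auto simp: R'_def)
  qed
qed

text \<open>
  Let \<open>p\<close> be of least degree in the kernel at \<open>x\<close>, let \<open>y\<close> be a root of the image of \<open>p\<close> in \<open>G\<close>, and let
  \<open>d\<close> be of least degree in the kernel at \<open>y\<close>. Up to a constant factor, \<open>p\<close> is \<open>d\<close> times some \<open>s\<close> of smaller
  degree than \<open>p\<close>, so \<open>s\<close> does not vanish at \<open>x\<close> and \<open>d\<close> does. Thus \<open>d\<close> has least degree in both kernels
  and determines both.
\<close>

lemma conjugate_exists:
  assumes "algebraically_closed G" and x: "x \<in> carrier F"
    and p0: "p0 \<in> carrier (UP pair_ring)" "p0 \<noteq> \<zero>\<^bsub>UP pair_ring\<^esub>" "eval_left x p0 = \<zero>\<^bsub>F\<^esub>"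
  obtains y where "y \<in> carrier G"
    "\<And>p. p \<in> carrier (UP pair_ring) \<Longrightarrow> eval_left x p = \<zero>\<^bsub>F\<^esub> \<longleftrightarrow> eval_right y p = \<zero>\<^bsub>G\<^esub>"
proof -
  interpret P: UP_domain pair_ring "UP pair_ring" by (rule UP_domain_pair_ring)
  interpret e1: ring_hom_cring "UP pair_ring" F "eval_left x" by (rule eval_left_hom[OF x])
  let ?ker1 = "\<lambda>p. p \<in> carrier (UP pair_ring) \<and> p \<noteq> \<zero>\<^bsub>UP pair_ring\<^esub> \<and> eval_left x p = \<zero>\<^bsub>F\<^esub>"
  \<comment> \<open>Nonzero constants have two nonzero components, so they lie in neither kernel.\<close>
  have deg_pos: "deg pair_ring p > 0" if "p \<in> carrier (UP pair_ring)" "p \<noteq> \<zero>\<^bsub>UP pair_ring\<^esub>"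
    "eval_left z p = \<zero>\<^bsub>F\<^esub> \<and> z \<in> carrier F \<or> eval_right w p = \<zero>\<^bsub>G\<^esub> \<and> w \<in> carrier G" for p z w
  proof (rule ccontr)
    assume "\<not> deg pair_ring p > 0"
    define c where "c = up_ring.coeff (UP pair_ring) p 0"
    have p: "p = up_ring.monom (UP pair_ring) c 0"
      unfolding c_def using P.deg_zero_impl_monom[OF that(1)] \<open>\<not> deg pair_ring p > 0\<close> by blast
    have cR: "c \<in> R" using P.coeff_closed[OF that(1), of 0] by (simp add: c_def)
    have "c \<noteq> \<zero>\<^bsub>pair_ring\<^esub>" using p that(2) P.monom_zero[of 0] by auto
    then have "fst c \<noteq> \<zero>\<^bsub>F\<^esub>" "snd c \<noteq> \<zero>\<^bsub>G\<^esub>" using const_nonzero[OF cR] by blast+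
    then show False using that(3) eval_const(1)[OF cR, of z] eval_const(2)[OF cR, of w] unfolding p by auto
  qed
  obtain p where p: "?ker1 p" and pmin: "\<And>q. ?ker1 q \<Longrightarrow> deg pair_ring p \<le> deg pair_ring q"
    using ex_has_least_nat[of ?ker1 p0 "deg pair_ring"] p0 by blast
  have "\<exists>y\<in>carrier G. psum G (deg pair_ring p) (\<lambda>i. snd (up_ring.coeff (UP pair_ring) p i)) y = \<zero>\<^bsub>G\<^esub>"
  proof (rule algebraically_closed_psum_root[OF assms(1)])
    show "0 < deg pair_ring p" using deg_pos[of p x] p x by blast
    show "snd (up_ring.coeff (UP pair_ring) p i) \<in> carrier G" for i
      using P.coeff_closed[of p i] p in_carrier[of "fst (up_ring.coeff (UP pair_ring) p i)" "snd (up_ring.coeff (UP pair_ring) p i)"]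
      by simp
    show "snd (up_ring.coeff (UP pair_ring) p (deg pair_ring p)) \<noteq> \<zero>\<^bsub>G\<^esub>"
      using const_nonzero[of "P.lcoeff p"] P.lcoeff_closed[of p] P.lcoeff_nonzero2[of p] p by simp
  qed
  then obtain y where y: "y \<in> carrier G" "eval_right y p = \<zero>\<^bsub>G\<^esub>"
    using eval_right_psum p by auto
  interpret e2: ring_hom_cring "UP pair_ring" G "eval_right y" by (rule eval_right_hom[OF y(1)])
  let ?ker2 = "\<lambda>p. p \<in> carrier (UP pair_ring) \<and> p \<noteq> \<zero>\<^bsub>UP pair_ring\<^esub> \<and> eval_right y p = \<zero>\<^bsub>G\<^esub>"
  obtain d where d: "?ker2 d" and dmin: "\<And>q. ?ker2 q \<Longrightarrow> deg pair_ring d \<le> deg pair_ring q"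
    using ex_has_least_nat[of ?ker2 p "deg pair_ring"] p y by blast
  have c1: "eval_left x (up_ring.monom (UP pair_ring) c 0) \<noteq> \<zero>\<^bsub>F\<^esub>" and c2: "eval_right y (up_ring.monom (UP pair_ring) c 0) \<noteq> \<zero>\<^bsub>G\<^esub>"
    if "c \<in> carrier pair_ring" "c \<noteq> \<zero>\<^bsub>pair_ring\<^esub>" for c
    using that const_nonzero[of c] eval_const[of c] x y by simp_all
  have K2: "eval_right y q = \<zero>\<^bsub>G\<^esub> \<longleftrightarrow> (\<exists>(k::nat) s. s \<in> carrier (UP pair_ring) \<and> P.lcoeff d [^]\<^bsub>pair_ring\<^esub> k \<odot>\<^bsub>UP pair_ring\<^esub> q = d \<otimes>\<^bsub>UP pair_ring\<^esub> s)"
    if "q \<in> carrier (UP pair_ring)" for q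
    by (rule P.kernel_iff_pseudo_divides[OF e2.ring_hom_cring_axioms G.domain_axioms c2])
       (use d dmin that in auto)
  obtain k :: nat and s where s: "s \<in> carrier (UP pair_ring)" "P.lcoeff d [^]\<^bsub>pair_ring\<^esub> k \<odot>\<^bsub>UP pair_ring\<^esub> p = d \<otimes>\<^bsub>UP pair_ring\<^esub> s"
    using K2[of p] p y by blast
  have lc: "P.lcoeff d [^]\<^bsub>pair_ring\<^esub> k \<in> carrier pair_ring" "P.lcoeff d [^]\<^bsub>pair_ring\<^esub> k \<noteq> \<zero>\<^bsub>pair_ring\<^esub>"
    using P.lcoeff_nonzero2[of d] d P.R.nat_pow_closed[OF P.lcoeff_closed[of d]]
      P.R.nat_pow_nonzero[OF P.lcoeff_closed[of d]] by blast+
  have degs: "deg pair_ring p = deg pair_ring (d \<otimes>\<^bsub>UP pair_ring\<^esub> s)"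
    using P.deg_smult[OF lc(1), of p] lc(2) p s(2) by simp
  have s0: "s \<noteq> \<zero>\<^bsub>UP pair_ring\<^esub>"
  proof
    assume "s = \<zero>\<^bsub>UP pair_ring\<^esub>"
    then have "deg pair_ring p = 0" using degs d by simp
    then show False using deg_pos[of p x] p x by simp
  qed
  have "deg pair_ring p = deg pair_ring d + deg pair_ring s" using degs s0 s(1) d by simp
  moreover have "deg pair_ring d > 0" using deg_pos[of d _ y] d y by blast
  ultimately have "deg pair_ring s < deg pair_ring p" by simp
  then have e1s: "eval_left x s \<noteq> \<zero>\<^bsub>F\<^esub>" using pmin[of s] s0 s(1) by fastforce
  have "eval_left x (d \<otimes>\<^bsub>UP pair_ring\<^esub> s) = \<zero>\<^bsub>F\<^esub>"
    using lc p unfolding s(2)[symmetric] by (simp add: P.monom_mult_is_smult[symmetric])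
  then have "eval_left x d = \<zero>\<^bsub>F\<^esub>"
    using e1s d s(1) F.integral[of "eval_left x d" "eval_left x s"] by simp
  moreover from dmin[of p] have "deg pair_ring d \<le> deg pair_ring p" using p y by blast
  ultimately have K1: "eval_left x q = \<zero>\<^bsub>F\<^esub> \<longleftrightarrow> (\<exists>(k::nat) s. s \<in> carrier (UP pair_ring) \<and> P.lcoeff d [^]\<^bsub>pair_ring\<^esub> k \<odot>\<^bsub>UP pair_ring\<^esub> q = d \<otimes>\<^bsub>UP pair_ring\<^esub> s)"
    if "q \<in> carrier (UP pair_ring)" for q
    by (intro P.kernel_iff_pseudo_divides[OF e1.ring_hom_cring_axioms F.domain_axioms c1])
       (use d pmin that order_trans in blast)+
  show thesis by (rule that[OF y(1)]) (simp add: K1 K2)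
qed

end

lemma psum_cong: "(\<And>i. i \<le> n \<Longrightarrow> c i = d i) \<Longrightarrow> (\<And>i. i \<le> n \<Longrightarrow> d i \<in> carrier F) \<Longrightarrow> cring F
   \<Longrightarrow> x \<in> carrier F \<Longrightarrow> psum F n c x = psum F n d x"
proof -
  assume a: "\<And>i. i \<le> n \<Longrightarrow> c i = d i" "\<And>i. i \<le> n \<Longrightarrow> d i \<in> carrier F" "cring F" "x \<in> carrier F"
  interpret cring F by fact
  show ?thesis unfolding psum_def using a by (intro finsum_cong') auto
qed

context partial_iso
begin

text \<open>
  A root of a polynomial over the domain of the isomorphism becomes an element of the kernel of the
  left evaluation.
\<close>

lemma polynomial_of_pairs:
  assumes R: "\<And>i. i \<le> n \<Longrightarrow> (c i, d i) \<in> R" and n: "c n \<noteq> \<zero>\<^bsub>F\<^esub>"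
  obtains p where "p \<in> carrier (UP pair_ring)" "p \<noteq> \<zero>\<^bsub>UP pair_ring\<^esub>"
    "\<And>x. x \<in> carrier F \<Longrightarrow> eval_left x p = psum F n c x"
    "\<And>y. y \<in> carrier G \<Longrightarrow> eval_right y p = psum G n d y"
proof
  interpret P: UP_domain pair_ring "UP pair_ring" by (rule UP_domain_pair_ring)
  define p where "p = (\<lambda>i. if i \<le> n then (c i, d i) else \<zero>\<^bsub>pair_ring\<^esub>)"
  have "p i \<in> carrier pair_ring" for i
  proof (cases "i \<le> n")
    case True then show ?thesis using R[of i] by (simp add: p_def)
  next
    case False then show ?thesis using P.R.zero_closed unfolding p_def by simp
  qed
  moreover have "bound \<zero>\<^bsub>pair_ring\<^esub> n p" unfolding bound_def p_def by simp
  ultimately have up: "p \<in> up pair_ring" unfolding up_def by (intro CollectI conjI Pi_I exI[of _ n]) 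
  then show p: "p \<in> carrier (UP pair_ring)" unfolding UP_def by simp
  have co: "up_ring.coeff (UP pair_ring) p i = p i" for i unfolding UP_def using up by simp
  have pn: "p n \<noteq> \<zero>\<^bsub>pair_ring\<^esub>" using n unfolding p_def by (simp add: RDirProd_simps)
  have deg: "deg pair_ring p = n"
  proof (rule le_antisym[OF P.deg_aboveI[OF _ p] P.deg_belowI[OF _ p]])
    show "up_ring.coeff (UP pair_ring) p m = \<zero>\<^bsub>pair_ring\<^esub>" if "n < m" for m using that unfolding co by (simp add: p_def)
    show "up_ring.coeff (UP pair_ring) p n \<noteq> \<zero>\<^bsub>pair_ring\<^esub>" using pn unfolding co .
  qed
  show "p \<noteq> \<zero>\<^bsub>UP pair_ring\<^esub>"
  proof
    assume "p = \<zero>\<^bsub>UP pair_ring\<^esub>"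
    then have "up_ring.coeff (UP pair_ring) p n = \<zero>\<^bsub>pair_ring\<^esub>" using P.coeff_zero[of n] by (simp only:)
    then show False using pn unfolding co by contradiction
  qed
  have le: "p i = (c i, d i)" "c i \<in> carrier F" "d i \<in> carrier G" if "i \<le> n" for i
    using in_carrier[OF R[OF that]] that unfolding p_def by simp_all
  show "eval_left x p = psum F n c x" if "x \<in> carrier F" for x
    unfolding eval_left_psum[OF p] deg co
    by (intro psum_cong F.is_cring that) (simp_all add: le)
  show "eval_right y p = psum G n d y" if "y \<in> carrier G" for y
    unfolding eval_right_psum[OF p] deg co
    by (intro psum_cong G.is_cring that) (simp_all add: le)
qed

lemma subring_Domain: "subring (Domain R) F"
proof (rule F.subringI)
  show "Domain R \<subseteq> carrier F" using in_carrier by blast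
  show "\<one>\<^bsub>F\<^esub> \<in> Domain R" using one_mem by blast
qed (auto dest: uminus_mem mult_mem add_mem)

text \<open>
  The difference of two pairs with equal left components has left component zero.
\<close>

lemma functional: "(a, b) \<in> R \<Longrightarrow> (a, b') \<in> R \<Longrightarrow> b = b'"
proof -
  assume ab: "(a, b) \<in> R" "(a, b') \<in> R"
  have "(a \<oplus>\<^bsub>F\<^esub> \<ominus>\<^bsub>F\<^esub> a, b \<oplus>\<^bsub>G\<^esub> \<ominus>\<^bsub>G\<^esub> b') \<in> R"
    by (intro add_mem uminus_mem ab)
  then have "b \<ominus>\<^bsub>G\<^esub> b' = \<zero>\<^bsub>G\<^esub>"
    using zero_iff[of "a \<oplus>\<^bsub>F\<^esub> \<ominus>\<^bsub>F\<^esub> a" "b \<oplus>\<^bsub>G\<^esub> \<ominus>\<^bsub>G\<^esub> b'"] in_carrier[OF ab(1)]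
    by (simp add: F.r_neg a_minus_def)
  then show "b = b'" using in_carrier ab by simp
qed

text \<open>
  An element outside a relatively closed subring is transcendental over it.
\<close>

lemma eval_left_eq_zero_iff:
  assumes "relatively_closed F (Domain R)" "x \<in> carrier F" "x \<notin> Domain R" "p \<in> carrier (UP pair_ring)"
  shows "eval_left x p = \<zero>\<^bsub>F\<^esub> \<longleftrightarrow> p = \<zero>\<^bsub>UP pair_ring\<^esub>"
proof
  interpret P: UP_domain pair_ring "UP pair_ring" by (rule UP_domain_pair_ring)
  interpret e1: ring_hom_cring "UP pair_ring" F "eval_left x" by (rule eval_left_hom) fact
  show "p = \<zero>\<^bsub>UP pair_ring\<^esub> \<Longrightarrow> eval_left x p = \<zero>\<^bsub>F\<^esub>" by simp
  assume z: "eval_left x p = \<zero>\<^bsub>F\<^esub>"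
  show "p = \<zero>\<^bsub>UP pair_ring\<^esub>"
  proof (rule ccontr)
    assume "p \<noteq> \<zero>\<^bsub>UP pair_ring\<^esub>"
    have co: "up_ring.coeff (UP pair_ring) p i \<in> R" for i
      using P.coeff_closed[OF assms(4)] by simp
    have "x \<in> Domain R"
    proof (rule relatively_closedD[OF assms(1) _ _ assms(2)])
      show "psum F (deg pair_ring p) (\<lambda>i. fst (up_ring.coeff (UP pair_ring) p i)) x = \<zero>\<^bsub>F\<^esub>"
        using z eval_left_psum[OF assms(4)] by simp
      show "fst (up_ring.coeff (UP pair_ring) p i) \<in> Domain R" for i
        using co[of i] by (metis Domain.DomainI prod.collapse)
      show "fst (P.lcoeff p) \<noteq> \<zero>\<^bsub>F\<^esub>"
        using const_nonzero[OF co] P.lcoeff_nonzero2[OF assms(4)] \<open>p \<noteq> \<zero>\<^bsub>UP pair_ring\<^esub>\<close> by blast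
    qed
    then show False using assms(3) by blast
  qed
qed

lemma eval_right_eq_zero_iff:
  assumes "relatively_closed G (Range R)" "y \<in> carrier G" "y \<notin> Range R" "p \<in> carrier (UP pair_ring)"
  shows "eval_right y p = \<zero>\<^bsub>G\<^esub> \<longleftrightarrow> p = \<zero>\<^bsub>UP pair_ring\<^esub>"
proof
  interpret P: UP_domain pair_ring "UP pair_ring" by (rule UP_domain_pair_ring)
  interpret e2: ring_hom_cring "UP pair_ring" G "eval_right y" by (rule eval_right_hom) fact
  show "p = \<zero>\<^bsub>UP pair_ring\<^esub> \<Longrightarrow> eval_right y p = \<zero>\<^bsub>G\<^esub>" by simp
  assume z: "eval_right y p = \<zero>\<^bsub>G\<^esub>"
  show "p = \<zero>\<^bsub>UP pair_ring\<^esub>"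
  proof (rule ccontr)
    assume "p \<noteq> \<zero>\<^bsub>UP pair_ring\<^esub>"
    have co: "up_ring.coeff (UP pair_ring) p i \<in> R" for i
      using P.coeff_closed[OF assms(4)] by simp
    have "y \<in> Range R"
    proof (rule relatively_closedD[OF assms(1) _ _ assms(2)])
      show "psum G (deg pair_ring p) (\<lambda>i. snd (up_ring.coeff (UP pair_ring) p i)) y = \<zero>\<^bsub>G\<^esub>"
        using z eval_right_psum[OF assms(4)] by simp
      show "snd (up_ring.coeff (UP pair_ring) p i) \<in> Range R" for i
        using co[of i] by (metis Range.RangeI prod.collapse)
      show "snd (P.lcoeff p) \<noteq> \<zero>\<^bsub>G\<^esub>"
        using const_nonzero[OF co] P.lcoeff_nonzero2[OF assms(4)] \<open>p \<noteq> \<zero>\<^bsub>UP pair_ring\<^esub>\<close> by blast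
    qed
    then show False using assms(3) by blast
  qed
qed

end

section \<open>Maximal partial isomorphisms\<close>

text \<open>
  Independence along a well-order: no member lies in the closure of the earlier ones. Spanning families
  of this kind are found greedily, whereas for independence as a property of sets one would need the
  exchange property to see that a maximal independent set spans.
\<close>

definition acl_independent :: "('a, 'm) ring_scheme \<Rightarrow> 'i rel \<Rightarrow> ('i \<Rightarrow> 'a) \<Rightarrow> bool" where
  "acl_independent F r f \<longleftrightarrow> (\<forall>i\<in>Field r. f i \<in> carrier F \<and> f i \<notin> acl F (f ` underS r i))"

definition down_closed :: "'i rel \<Rightarrow> 'i set \<Rightarrow> bool" where
  "down_closed r T \<longleftrightarrow> T \<subseteq> Field r \<and> (\<forall>i\<in>T. \<forall>j. (j, i) \<in> r \<longrightarrow> j \<in> T)"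

definition matched :: "'i rel \<Rightarrow> ('i \<Rightarrow> 'a) \<Rightarrow> ('i \<Rightarrow> 'b) \<Rightarrow> ('a \<times> 'b) set \<Rightarrow> 'i set" where
  "matched r f g R = {i \<in> Field r. (f i, g i) \<in> R}"

text \<open>
  For an isomorphism that is admissible, the part of the base that it covers is an initial segment,
  and all else in it is algebraic over that part. This keeps the next base elements transcendental
  on both sides.
\<close>

definition admissible ::
  "('a, 'm) ring_scheme \<Rightarrow> ('b, 'n) ring_scheme \<Rightarrow> 'i rel \<Rightarrow> ('i \<Rightarrow> 'a) \<Rightarrow> ('i \<Rightarrow> 'b) \<Rightarrow> ('a \<times> 'b) set \<Rightarrow> bool" where
  "admissible F G r f g R \<longleftrightarrow> partial_iso F G R \<and> down_closed r (matched r f g R) \<and>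
     Domain R \<subseteq> acl F (f ` matched r f g R) \<and> Range R \<subseteq> acl G (g ` matched r f g R)"

lemma matched_converse: "matched r g f (R\<inverse>) = matched r f g R"
  by (simp add: matched_def)

lemma admissible_converse: "admissible F G r f g R \<Longrightarrow> admissible G F r g f (R\<inverse>)"
  by (simp add: admissible_def matched_converse partial_iso_converse)

text \<open>
  An index \<open>i\<close> outside an initial segment \<open>T\<close> is above all of \<open>T\<close>, so \<open>f i\<close> in the closure of \<open>f ` T\<close> would
  lie in the closure of its predecessors.
\<close>

lemma acl_independent_down_closed:
  assumes "Well_order r" "acl_independent F r f" "down_closed r T" "i \<in> Field r" "f i \<in> acl F (f ` T)"
  shows "i \<in> T"
proof (rule ccontr)
  assume i: "i \<notin> T"
  have "T \<subseteq> underS r i"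
  proof
    fix t assume t: "t \<in> T"
    then have "t \<in> Field r" "(i, t) \<notin> r" "t \<noteq> i" using i assms(3) by (auto simp: down_closed_def)
    moreover have "Total r" using assms(1) by (simp add: well_order_on_def linear_order_on_def)
    ultimately have "(t, i) \<in> r" using assms(4) by (auto simp: total_on_def)
    then show "t \<in> underS r i" using \<open>t \<noteq> i\<close> by (simp add: underS_def)
  qed
  then have "acl F (f ` T) \<subseteq> acl F (f ` underS r i)" by (intro acl_mono image_mono)
  then show False using assms(2,4,5) by (auto simp: acl_independent_def)
qed

text \<open>
  If the domain is algebraic over an initial segment \<open>T\<close> of the base, then no base element beyond \<open>T\<close> can
  be matched, so \<open>T\<close> is all that is matched.
\<close>

lemma admissibleI:
  assumes "Well_order r" "acl_independent F r f" "partial_iso F G R" "down_closed r T"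
    "T \<subseteq> matched r f g R" "Domain R \<subseteq> acl F (f ` T)" "Range R \<subseteq> acl G (g ` T)"
  shows "admissible F G r f g R"
proof -
  have "i \<in> T" if "i \<in> matched r f g R" for i
    using acl_independent_down_closed[OF assms(1,2,4), of i] that assms(6) by (auto simp: matched_def)
  then have "matched r f g R = T" using assms(5) by blast
  then show ?thesis using assms by (simp add: admissible_def)
qed

text \<open>
  An element that is algebraic over the domain can be adjoined together with a conjugate in \<open>G\<close>.
  Both lie in the closures of the matched base elements, so the result is admissible and
  maximality puts the element into the domain.
\<close>

lemma maximal_admissible_relatively_closed:
  assumes "Well_order r" "acl_independent F r f" "acl_independent G r g" "algebraically_closed G"
    and M: "admissible F G r f g M"
    and maximal: "\<And>R. admissible F G r f g R \<Longrightarrow> M \<subseteq> R \<Longrightarrow> R = M"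
  shows "relatively_closed F (Domain M)"
  unfolding relatively_closed_def
proof (intro conjI allI impI)
  interpret M: partial_iso F G M using M by (simp add: admissible_def)
  show "subring (Domain M) F" by (rule M.subring_Domain)
  let ?T = "matched r f g M"
  have T: "f ` ?T \<subseteq> carrier F" "g ` ?T \<subseteq> carrier G"
    using M.in_carrier by (auto simp: matched_def)
  note clF = M.F.relatively_closed_acl[OF T(1)] and clG = M.G.relatively_closed_acl[OF T(2)]
  have MT: "Domain M \<subseteq> acl F (f ` ?T)" "Range M \<subseteq> acl G (g ` ?T)" "down_closed r ?T"
    using M by (simp_all add: admissible_def)
  fix n c x
  assume *: "(\<forall>i\<le>n. c i \<in> Domain M) \<and> c n \<noteq> \<zero>\<^bsub>F\<^esub> \<and> x \<in> carrier F \<and> psum F n c x = \<zero>\<^bsub>F\<^esub>"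
  then have cx: "\<And>i. i \<le> n \<Longrightarrow> c i \<in> Domain M" "c n \<noteq> \<zero>\<^bsub>F\<^esub>" "x \<in> carrier F"
      "psum F n c x = \<zero>\<^bsub>F\<^esub>" by blast+
  define d where "d i = (SOME b. (c i, b) \<in> M)" for i
  have d: "(c i, d i) \<in> M" if "i \<le> n" for i
    unfolding d_def using cx(1)[OF that] by (auto intro: someI_ex)
  obtain p where p: "p \<in> carrier (UP M.pair_ring)" "p \<noteq> \<zero>\<^bsub>UP M.pair_ring\<^esub>"
      "\<And>x. x \<in> carrier F \<Longrightarrow> M.eval_left x p = psum F n c x"
      "\<And>y. y \<in> carrier G \<Longrightarrow> M.eval_right y p = psum G n d y"
    using M.polynomial_of_pairs[of n c d, OF d cx(2)] by blast
  have x: "x \<in> carrier F" "M.eval_left x p = \<zero>\<^bsub>F\<^esub>" using cx(3,4) p(3)[OF cx(3)] by simp_all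
  obtain y where y: "y \<in> carrier G"
      "\<And>p. p \<in> carrier (UP M.pair_ring) \<Longrightarrow> M.eval_left x p = \<zero>\<^bsub>F\<^esub> \<longleftrightarrow> M.eval_right y p = \<zero>\<^bsub>G\<^esub>"
    using M.conjugate_exists[OF assms(4) x(1) p(1,2) x(2)] by blast
  obtain R where R: "partial_iso F G R" "M \<subseteq> R" "(x, y) \<in> R"
    "\<And>K. subring K F \<Longrightarrow> Domain M \<subseteq> K \<Longrightarrow> x \<in> K \<Longrightarrow> Domain R \<subseteq> K"
    "\<And>K. subring K G \<Longrightarrow> Range M \<subseteq> K \<Longrightarrow> y \<in> K \<Longrightarrow> Range R \<subseteq> K"
    using M.simple_extension_exists[OF x(1) y] by blast
  have "x \<in> acl F (f ` ?T)"
  proof (rule relatively_closedD[OF clF])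
    show "c i \<in> acl F (f ` ?T)" if "i \<le> n" for i using cx(1)[OF that] MT(1) by blast
  qed (rule cx)+
  then have dom: "Domain R \<subseteq> acl F (f ` ?T)"
    using clF MT(1) by (intro R(4)) (simp_all add: relatively_closed_def)
  have dy: "psum G n d y = \<zero>\<^bsub>G\<^esub>" using y(2)[OF p(1)] p(4)[OF y(1)] x(2) by simp
  have dn: "d n \<noteq> \<zero>\<^bsub>G\<^esub>" using M.zero_iff[OF d[of n]] cx(2) by simp
  have "y \<in> acl G (g ` ?T)"
  proof (rule relatively_closedD[OF clG])
    show "d i \<in> acl G (g ` ?T)" if "i \<le> n" for i using d[OF that] MT(2) by blast
  qed (rule dn y(1) dy)+
  then have ran: "Range R \<subseteq> acl G (g ` ?T)"
    using clG MT(2) by (intro R(5)) (simp_all add: relatively_closed_def)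
  have "?T \<subseteq> matched r f g R" using R(2) by (auto simp: matched_def)
  then have "admissible F G r f g R"
    using admissibleI[OF assms(1,2) R(1) MT(3)] dom ran by blast
  then have "R = M" using maximal R(2) by blast
  then show "x \<in> Domain M" using R(3) by blast
qed

text \<open>
  The isomorphism between the prime rings, which starts the construction. In characteristic zero both
  prime rings are copies of the integers.
\<close>

definition int_multiples :: "('a, 'm) ring_scheme \<Rightarrow> ('b, 'n) ring_scheme \<Rightarrow> ('a \<times> 'b) set" where
  "int_multiples F G = range (\<lambda>k::int. (add_pow F (k) \<one>\<^bsub>F\<^esub>, add_pow G (k) \<one>\<^bsub>G\<^esub>))"

lemma (in ring) int_multiple_one:
  "\<ominus> (add_pow R (k::int) \<one>) = add_pow R (-k) \<one>"
  "add_pow R (k::int) \<one> \<oplus> add_pow R (l) \<one> = add_pow R (k + l) \<one>"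
  "add_pow R (k::int) \<one> \<otimes> add_pow R (l) \<one> = add_pow R (k * l) \<one>"
proof -
  show "\<ominus> (add_pow R (k::int) \<one>) = add_pow R (-k) \<one>" by (simp add: add.int_pow_neg)
  show "add_pow R (k::int) \<one> \<oplus> add_pow R (l) \<one> = add_pow R (k + l) \<one>" by (simp add: add.int_pow_mult)
  have "add_pow R (k::int) \<one> \<otimes> add_pow R (l) \<one> = add_pow R k (add_pow R l \<one>)" by (simp add: add_pow_ldistr_int)
  also have "\<dots> = add_pow R (k * l) \<one>" using add.int_pow_pow[of \<one> k l] by (simp add: mult.commute)
  finally show "add_pow R (k::int) \<one> \<otimes> add_pow R (l) \<one> = add_pow R (k * l) \<one>" .
qed

lemma (in ring) int_multiple_in_subring:
  assumes "subring K R"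
  shows "add_pow R (k::int) \<one> \<in> K"
proof -
  have "add_pow R (n::nat) \<one> \<in> K" for n
    by (induction n) (use subringE(2,3,7)[OF assms] in auto)
  then show ?thesis
    using subringE(5)[OF assms] add_pow_int_ge[of k R \<one>] add_pow_int_lt[of k R \<one>] by (cases "k \<ge> 0") auto
qed

lemma (in ring) int_multiple_eq_zero_iff:
  assumes "characteristic_zero R"
  shows "add_pow R (k::int) \<one> = \<zero> \<longleftrightarrow> k = 0"
proof (cases "k \<ge> 0")
  case True
  then show ?thesis using assms add_pow_int_ge[of k R \<one>] 
    by (cases "k = 0") (auto simp: characteristic_zero_def)
next
  case False
  then have "add_pow R (nat (-k)) \<one> \<noteq> \<zero>" using assms by (simp add: characteristic_zero_def)
  then show ?thesis using False add_pow_int_lt[of k R \<one>] by (simp add: add.inv_eq_1_iff)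
qed

lemma partial_iso_int_multiples:
  assumes "field F" "field G" "characteristic_zero F" "characteristic_zero G"
  shows "partial_iso F G (int_multiples F G)"
proof -
  interpret F: field F by fact
  interpret G: field G by fact
  show ?thesis
  proof (rule partial_isoI[OF assms(1,2)])
    show "(\<one>\<^bsub>F\<^esub>, \<one>\<^bsub>G\<^esub>) \<in> int_multiples F G"
      unfolding int_multiples_def by (rule image_eqI[of _ _ 1]) simp_all
  qed (auto simp: int_multiples_def F.int_multiple_one G.int_multiple_one
      F.int_multiple_eq_zero_iff G.int_multiple_eq_zero_iff assms)
qed

lemma partial_iso_Union_chain:
  assumes "C \<noteq> {}" "\<And>R R'. R \<in> C \<Longrightarrow> R' \<in> C \<Longrightarrow> R \<subseteq> R' \<or> R' \<subseteq> R" "\<And>R. R \<in> C \<Longrightarrow> partial_iso F G R"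
  shows "partial_iso F G (\<Union>C)"
proof -
  obtain R0 where R0: "R0 \<in> C" using assms(1) by blast
  interpret R0: partial_iso F G R0 by (rule assms(3)[OF R0])
  have common: "\<exists>R\<in>C. u \<in> R \<and> v \<in> R" if "u \<in> \<Union>C" "v \<in> \<Union>C" for u v
    using that assms(2) by blast
  show ?thesis
  proof (rule partial_isoI)
    show "field F" "field G" by unfold_locales
    show "\<Union>C \<subseteq> carrier F \<times> carrier G" 
    proof clarify
      fix a b R assume "(a, b) \<in> R" "R \<in> C"
      then show "a \<in> carrier F \<and> b \<in> carrier G" using partial_iso.in_carrier[OF assms(3)] by blast
    qed
    show "(\<one>\<^bsub>F\<^esub>, \<one>\<^bsub>G\<^esub>) \<in> \<Union>C" using R0.one_mem R0 by blast
    show "(\<ominus>\<^bsub>F\<^esub> a, \<ominus>\<^bsub>G\<^esub> b) \<in> \<Union>C" if "(a, b) \<in> \<Union>C" for a b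
      using that partial_iso.uminus_mem[OF assms(3)] by blast
    show "(a \<otimes>\<^bsub>F\<^esub> c, b \<otimes>\<^bsub>G\<^esub> d) \<in> \<Union>C" if "(a, b) \<in> \<Union>C" "(c, d) \<in> \<Union>C" for a b c d
      using common[OF that] partial_iso.mult_mem[OF assms(3)] by blast
    show "(a \<oplus>\<^bsub>F\<^esub> c, b \<oplus>\<^bsub>G\<^esub> d) \<in> \<Union>C" if "(a, b) \<in> \<Union>C" "(c, d) \<in> \<Union>C" for a b c d
      using common[OF that] partial_iso.add_mem[OF assms(3)] by blast
    show "a = \<zero>\<^bsub>F\<^esub> \<longleftrightarrow> b = \<zero>\<^bsub>G\<^esub>" if "(a, b) \<in> \<Union>C" for a b
      using that partial_iso.zero_iff[OF assms(3)] by blast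
  qed
qed

lemma maximal_admissible_exists:
  assumes "field F" "field G" "characteristic_zero F" "characteristic_zero G"
    and r: "Well_order r" and f: "acl_independent F r f" and g: "acl_independent G r g"
  obtains M where "admissible F G r f g M" "\<And>R. admissible F G r f g R \<Longrightarrow> M \<subseteq> R \<Longrightarrow> R = M"
proof -
  interpret F: field F by fact
  interpret G: field G by fact
  have "\<exists>M\<in>Collect (admissible F G r f g). \<forall>R\<in>Collect (admissible F G r f g). M \<subseteq> R \<longrightarrow> R = M"
  proof (rule subset_Zorn_nonempty)
    have cl: "subring (acl F {}) F" "subring (acl G {}) G"
      using F.relatively_closed_acl[of "{}"] G.relatively_closed_acl[of "{}"]
      by (simp_all add: relatively_closed_def)
    have "admissible F G r f g (int_multiples F G)"
      using F.int_multiple_in_subring[OF cl(1)] G.int_multiple_in_subring[OF cl(2)]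
      by (intro admissibleI[OF r f partial_iso_int_multiples[OF assms(1-4)], where T="{}"])
         (auto simp: down_closed_def int_multiples_def)
    then show "Collect (admissible F G r f g) \<noteq> {}" by blast
  next
    fix C assume C: "C \<noteq> {}" "subset.chain (Collect (admissible F G r f g)) C"
    then have adm: "\<And>R. R \<in> C \<Longrightarrow> admissible F G r f g R"
      and ch: "\<And>R R'. R \<in> C \<Longrightarrow> R' \<in> C \<Longrightarrow> R \<subseteq> R' \<or> R' \<subseteq> R"
      by (auto simp: subset_chain_def)
    have m: "matched r f g (\<Union>C) = (\<Union>R\<in>C. matched r f g R)" by (auto simp: matched_def)
    have "admissible F G r f g (\<Union>C)"
      unfolding admissible_def
    proof (intro conjI)
      show "partial_iso F G (\<Union>C)"
        by (rule partial_iso_Union_chain[OF C(1) ch]) (use adm in \<open>auto simp: admissible_def\<close>)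
      show "down_closed r (matched r f g (\<Union>C))"
        unfolding m using adm by (fastforce simp: admissible_def down_closed_def)
      have "Domain R \<subseteq> acl F (f ` matched r f g (\<Union>C))" "Range R \<subseteq> acl G (g ` matched r f g (\<Union>C))"
        if "R \<in> C" for R
      proof -
        have "matched r f g R \<subseteq> matched r f g (\<Union>C)" using that by (auto simp: m)
        then show "Domain R \<subseteq> acl F (f ` matched r f g (\<Union>C))" "Range R \<subseteq> acl G (g ` matched r f g (\<Union>C))"
          using adm[OF that] acl_mono[OF image_mono] unfolding admissible_def by (meson order_trans)+
      qed
      then show "Domain (\<Union>C) \<subseteq> acl F (f ` matched r f g (\<Union>C))"
        "Range (\<Union>C) \<subseteq> acl G (g ` matched r f g (\<Union>C))" by blast+
    qed
    then show "\<Union>C \<in> Collect (admissible F G r f g)" by simp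
  qed
  then show thesis using that by blast
qed

text \<open>
  The two base elements of the first unmatched index lie outside the relatively closed domain and
  range, so both evaluations of polynomials at them have kernel zero and the pair could be adjoined.
\<close>

lemma maximal_admissible_matches_all:
  assumes r: "Well_order r" and f: "acl_independent F r f" and g: "acl_independent G r g"
    and M: "admissible F G r f g M"
    and maximal: "\<And>R. admissible F G r f g R \<Longrightarrow> M \<subseteq> R \<Longrightarrow> R = M"
    and dom: "relatively_closed F (Domain M)" and ran: "relatively_closed G (Range M)"
  shows "matched r f g M = Field r"
proof (rule ccontr)
  interpret M: partial_iso F G M using M by (simp add: admissible_def)
  let ?T = "matched r f g M"
  have MT: "Domain M \<subseteq> acl F (f ` ?T)" "Range M \<subseteq> acl G (g ` ?T)" "down_closed r ?T"
    using M by (simp_all add: admissible_def)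
  assume "?T \<noteq> Field r"
  then obtain i0 where "i0 \<in> Field r - ?T" by (auto simp: matched_def)
  moreover have "wf (r - Id)" using r by (simp add: well_order_on_def)
  ultimately obtain i where i: "i \<in> Field r" "i \<notin> ?T" "\<And>j. (j, i) \<in> r - Id \<Longrightarrow> j \<notin> Field r - ?T"
    using wfE_min[of "r - Id" i0 "Field r - ?T"] by blast
  have below: "j \<in> ?T" if "(j, i) \<in> r" "j \<noteq> i" for j
    using i(3)[of j] that by (auto simp: Field_def)
  have x: "f i \<in> carrier F" "f i \<notin> Domain M"
    using f i acl_independent_down_closed[OF r f MT(3)] MT(1) by (auto simp: acl_independent_def)
  have y: "g i \<in> carrier G" "g i \<notin> Range M"
    using g i acl_independent_down_closed[OF r g MT(3)] MT(2) by (auto simp: acl_independent_def)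
  have ker: "M.eval_left (f i) p = \<zero>\<^bsub>F\<^esub> \<longleftrightarrow> M.eval_right (g i) p = \<zero>\<^bsub>G\<^esub>" if "p \<in> carrier (UP M.pair_ring)" for p
    using M.eval_left_eq_zero_iff[OF dom x that] M.eval_right_eq_zero_iff[OF ran y that] by simp
  obtain R where R: "partial_iso F G R" "M \<subseteq> R" "(f i, g i) \<in> R"
    "\<And>K. subring K F \<Longrightarrow> Domain M \<subseteq> K \<Longrightarrow> f i \<in> K \<Longrightarrow> Domain R \<subseteq> K"
    "\<And>K. subring K G \<Longrightarrow> Range M \<subseteq> K \<Longrightarrow> g i \<in> K \<Longrightarrow> Range R \<subseteq> K"
    using M.simple_extension_exists[OF x(1) y(1) ker] by blast
  let ?U = "insert i ?T"
  have U: "f ` ?U \<subseteq> carrier F" "g ` ?U \<subseteq> carrier G"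
    using M.in_carrier x y by (auto simp: matched_def)
  have dU: "down_closed r ?U" using MT(3) below i(1) by (auto simp: down_closed_def)
  have "Domain R \<subseteq> acl F (f ` ?U)"
  proof (rule R(4))
    show "subring (acl F (f ` ?U)) F"
      using M.F.relatively_closed_acl[OF U(1)] by (simp add: relatively_closed_def)
    show "Domain M \<subseteq> acl F (f ` ?U)" using MT(1) acl_mono[of "f ` ?T" "f ` ?U" F] by blast
    show "f i \<in> acl F (f ` ?U)" using acl_extensive[of "f ` ?U" F] by blast
  qed
  moreover have "Range R \<subseteq> acl G (g ` ?U)"
  proof (rule R(5))
    show "subring (acl G (g ` ?U)) G"
      using M.G.relatively_closed_acl[OF U(2)] by (simp add: relatively_closed_def)
    show "Range M \<subseteq> acl G (g ` ?U)" using MT(2) acl_mono[of "g ` ?T" "g ` ?U" G] by blast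
    show "g i \<in> acl G (g ` ?U)" using acl_extensive[of "g ` ?U" G] by blast
  qed
  moreover have "?U \<subseteq> matched r f g R" using R(2,3) i(1) by (auto simp: matched_def)
  ultimately have "admissible F G r f g R" using admissibleI[OF r f R(1) dU] by blast
  then have "R = M" using maximal R(2) by blast
  then show False using R(3) x(2) by blast
qed

lemma (in partial_iso) is_ring_iso_if_total:
  assumes "Domain R = carrier F" "Range R = carrier G"
  shows "F \<simeq> G"
proof -
  interpret C: partial_iso G F "R\<inverse>" by (rule partial_iso_converse[OF partial_iso_axioms])
  define h where "h x = (THE y. (x, y) \<in> R)" for x
  have h: "h x = y \<longleftrightarrow> (x, y) \<in> R" if "x \<in> carrier F" for x y
  proof -
    obtain z where z: "(x, z) \<in> R" using \<open>x \<in> carrier F\<close> assms(1) by blast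
    then have "h x = z" unfolding h_def by (intro the_equality) (rule z, metis functional)
    then show ?thesis using z functional by blast
  qed
  have mem: "(x, h x) \<in> R" if "x \<in> carrier F" for x using h[OF that] by blast
  have "h \<in> ring_hom F G"
  proof (rule ring_hom_memI)
    show "h x \<in> carrier G" if "x \<in> carrier F" for x using mem[OF that] in_carrier by blast
  qed (simp_all add: h mem mult_mem add_mem one_mem)
  moreover have "bij_betw h (carrier F) (carrier G)"
  proof (intro bij_betwI')
    show "h x = h y \<longleftrightarrow> x = y" if "x \<in> carrier F" "y \<in> carrier F" for x y
      using C.functional[of "h x" x y] mem that by auto
    show "h x \<in> carrier G" if "x \<in> carrier F" for x using mem[OF that] in_carrier by blast
    show "\<exists>x\<in>carrier F. y = h x" if "y \<in> carrier G" for y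
    proof -
      obtain x where "(x, y) \<in> R" using \<open>y \<in> carrier G\<close> assms(2) by blast
      moreover from this have "x \<in> carrier F" using in_carrier by blast
      ultimately show ?thesis using h[of x y] by (intro bexI[of _ x]) simp_all
    qed
  qed
  ultimately show ?thesis by (auto simp: is_ring_iso_def ring_iso_def)
qed

text \<open>
  The domain and the range of a maximal admissible isomorphism are relatively closed and contain the
  bases, hence are everything. The statement on the range is the one on the domain for the
  converse relation, which is maximal admissible with the fields exchanged.
\<close>

theorem isomorphic_if_acl_bases:
  assumes "algebraically_closed F" "algebraically_closed G" "characteristic_zero F" "characteristic_zero G"
    and r: "Well_order r" and f: "acl_independent F r f" and g: "acl_independent G r g"
    and span: "acl F (f ` Field r) = carrier F" "acl G (g ` Field r) = carrier G"
  shows "F \<simeq> G"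
proof -
  have "field F" "field G" using assms(1,2) by (simp_all add: algebraically_closed_def)
  then obtain M where M: "admissible F G r f g M"
      and max: "\<And>R. admissible F G r f g R \<Longrightarrow> M \<subseteq> R \<Longrightarrow> R = M"
    using maximal_admissible_exists[OF _ _ assms(3,4) r f g] by blast
  interpret M: partial_iso F G M using M by (simp add: admissible_def)
  have dom: "relatively_closed F (Domain M)"
    by (rule maximal_admissible_relatively_closed[OF r f g assms(2) M max])
  have "relatively_closed G (Domain (M\<inverse>))"
  proof (rule maximal_admissible_relatively_closed[OF r g f assms(1) admissible_converse[OF M]])
    fix R assume R: "admissible G F r g f R" "M\<inverse> \<subseteq> R"
    have "M \<subseteq> R\<inverse>" using R(2) by auto
    then have "R\<inverse> = M" by (rule max[OF admissible_converse[OF R(1)]])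
    then show "R = M\<inverse>" by auto
  qed
  then have ran: "relatively_closed G (Range M)" by simp
  have all: "matched r f g M = Field r"
    by (rule maximal_admissible_matches_all[OF r f g M max dom ran])
  have "f ` Field r \<subseteq> Domain M" "g ` Field r \<subseteq> Range M"
    unfolding all[symmetric] by (auto simp: matched_def)
  then have "carrier F \<subseteq> Domain M" "carrier G \<subseteq> Range M"
    using acl_least[OF dom, of "f ` Field r"] acl_least[OF ran, of "g ` Field r"] span by simp_all
  then have "Domain M = carrier F" "Range M = carrier G" using M.in_carrier by auto
  then show ?thesis by (rule M.is_ring_iso_if_total)
qed

section \<open>Cardinality of the algebraic closure\<close>

lemma card_of_finite_le_Cinfinite:
  assumes "finite S" "Cinfinite \<kappa>"
  shows "|S| \<le>o \<kappa>"
proof (rule ordLess_imp_ordLeq[OF finite_ordLess_infinite])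
  show "Well_order \<kappa>" using assms(2) card_order_on_well_order_on by blast
qed (use assms in \<open>simp_all add: cinfinite_def card_of_Well_order Field_card_of\<close>)

text \<open>
  The lists of one length form a finite power of \<open>A\<close>, and there are countably many lengths.
\<close>

lemma card_of_lists_le:
  assumes "|A| \<le>o \<kappa>" "Cinfinite \<kappa>"
  shows "|lists A| \<le>o \<kappa>"
proof -
  have n: "|{xs \<in> lists A. length xs = n}| \<le>o \<kappa>" for n
  proof (induction n)
    case 0
    have "{xs \<in> lists A. length xs = 0} = {[]}" by auto
    then have "finite {xs \<in> lists A. length xs = 0}" by simp
    then show ?case using assms(2) by (rule card_of_finite_le_Cinfinite)
  next
    case (Suc n)
    have "{xs \<in> lists A. length xs = Suc n} = (\<lambda>(x, xs). x # xs) ` (A \<times> {xs \<in> lists A. length xs = n})"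
      by (auto simp: length_Suc_conv image_iff)
    moreover have "|A \<times> {xs \<in> lists A. length xs = n}| \<le>o \<kappa>"
      using card_of_Times_ordLeq_infinite_Field[of \<kappa> A "{xs \<in> lists A. length xs = n}"] assms Suc
      by (simp add: cinfinite_def)
    ultimately show ?case using ordLeq_transitive[OF card_of_image] by (simp only:)
  qed
  have "lists A = (\<Union>n. {xs \<in> lists A. length xs = n})" by auto
  moreover have "|\<Union>n. {xs \<in> lists A. length xs = n}| \<le>o \<kappa>"
  proof (rule UNION_Cinfinite_bound)
    show "|UNIV :: nat set| \<le>o \<kappa>"
      using natLeq_ordLeq_cinfinite[OF assms(2)] card_of_nat ordIso_ordLeq_trans by blast
  qed (use n assms(2) in auto)
  ultimately show ?thesis by (simp only:)
qed

text \<open>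
  The coefficients are listed with the constant term first. Lists that end in zero are given no
  roots, since the zero polynomial would contribute the whole field.
\<close>

definition list_roots :: "('a, 'm) ring_scheme \<Rightarrow> 'a list \<Rightarrow> 'a set" where
  "list_roots F p = (if last p = \<zero>\<^bsub>F\<^esub> then {} else {x \<in> carrier F. psum F (length p - 1) ((!) p) x = \<zero>\<^bsub>F\<^esub>})"

text \<open>
  One round of closing a set under the ring operations and under roots of polynomials with
  coefficients in the set.
\<close>

definition acl_step :: "('a, 'm) ring_scheme \<Rightarrow> 'a set \<Rightarrow> 'a set" where
  "acl_step F E = {\<one>\<^bsub>F\<^esub>} \<union> E \<union> a_inv F ` E \<union>
     (\<lambda>(a, b). a \<otimes>\<^bsub>F\<^esub> b) ` (E \<times> E) \<union> (\<lambda>(a, b). a \<oplus>\<^bsub>F\<^esub> b) ` (E \<times> E) \<union>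
     (\<Union>p \<in> lists E - {[]}. list_roots F p)"

lemma (in domain) finite_list_roots:
  assumes "p \<in> lists (carrier R)" "p \<noteq> []"
  shows "finite (list_roots R p)"
proof (cases "last p = \<zero>")
  case False
  have "finite {x \<in> carrier R. psum R (length p - 1) ((!) p) x = \<zero>}"
  proof (rule finite_psum_roots)
    show "p ! i \<in> carrier R" if "i \<le> length p - 1" for i
    proof -
      have "i < length p" using that assms(2) by (cases p) auto
      then show ?thesis using assms(1) by (auto simp: lists_eq_set intro!: subsetD[OF _ nth_mem])
    qed
    show "p ! (length p - 1) \<noteq> \<zero>" using False assms(2) by (simp add: last_conv_nth)
  qed
  then show ?thesis by (simp add: list_roots_def)
qed (simp add: list_roots_def)

lemma (in domain) acl_step_carrier: "E \<subseteq> carrier R \<Longrightarrow> acl_step R E \<subseteq> carrier R"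
  by (auto simp: acl_step_def list_roots_def split: if_splits)

lemma (in domain) card_acl_step:
  assumes "E \<subseteq> carrier R" "|E| \<le>o \<kappa>" "Cinfinite \<kappa>"
  shows "|acl_step R E| \<le>o \<kappa>"
proof -
  have EE: "|E \<times> E| \<le>o \<kappa>"
    using card_of_Times_ordLeq_infinite_Field[of \<kappa> E E] assms by (simp add: cinfinite_def)
  have "|\<Union>p \<in> lists E - {[]}. list_roots R p| \<le>o \<kappa>"
  proof (rule UNION_Cinfinite_bound[OF _ _ assms(3)])
    show "|lists E - {[]}| \<le>o \<kappa>"
      using card_of_lists_le[OF assms(2,3)] card_of_mono1[of "lists E - {[]}" "lists E"] ordLeq_transitive by blast
    show "\<forall>p\<in>lists E - {[]}. |list_roots R p| \<le>o \<kappa>"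
    proof
      fix p assume "p \<in> lists E - {[]}"
      then have "finite (list_roots R p)"
        using assms(1) by (intro finite_list_roots) auto
      then show "|list_roots R p| \<le>o \<kappa>" using assms(3) by (rule card_of_finite_le_Cinfinite)
    qed
  qed
  moreover have "|h ` E| \<le>o \<kappa>" for h :: "'a \<Rightarrow> 'a"
    using card_of_image assms(2) by (rule ordLeq_transitive)
  moreover have "|h ` (E \<times> E)| \<le>o \<kappa>" for h :: "'a \<times> 'a \<Rightarrow> 'a"
    using card_of_image EE by (rule ordLeq_transitive)
  ultimately show ?thesis
    unfolding acl_step_def using assms(2,3) card_of_finite_le_Cinfinite[of "{\<one>}"]
    by (intro Un_Cinfinite_bound) simp_all
qed

text \<open>
  The union of the iterated closing steps is relatively closed, as the finitely many
  coefficients of a polynomial all occur at some stage. Each step adds at most \<open>\<kappa>\<close> elements because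
  there are at most \<open>\<kappa>\<close> polynomials and each has finitely many roots.
\<close>

lemma (in field) card_acl:
  assumes A: "A \<subseteq> carrier R" "|A| \<le>o \<kappa>" and "Cinfinite \<kappa>"
  shows "|acl R A| \<le>o \<kappa>"
proof -
  define E where "E n = (acl_step R ^^ n) A" for n
  have E_Suc: "E (Suc n) = acl_step R (E n)" for n by (simp add: E_def)
  have inc: "E n \<subseteq> E (Suc n)" for n unfolding E_Suc acl_step_def by blast
  then have mono: "m \<le> n \<Longrightarrow> E m \<subseteq> E n" for m n by (rule lift_Suc_mono_le)
  have car: "E n \<subseteq> carrier R" for n
    by (induction n) (use A(1) in \<open>simp_all add: E_Suc acl_step_carrier\<close>, simp add: E_def)
  have card: "|E n| \<le>o \<kappa>" for n
    by (induction n) (use A(2) in \<open>simp add: E_def\<close>, simp add: E_Suc card_acl_step[OF car _ assms(3)])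
  define Y where "Y = (\<Union>n. E n)"
  have common: "\<exists>n. a \<in> E n \<and> b \<in> E n" if "a \<in> Y" "b \<in> Y" for a b
  proof -
    obtain m n where "a \<in> E m" "b \<in> E n" using \<open>a \<in> Y\<close> \<open>b \<in> Y\<close> by (auto simp: Y_def)
    then show ?thesis using mono[of m "max m n"] mono[of n "max m n"] by fastforce
  qed
  have Suc_in: "a \<in> acl_step R (E n) \<Longrightarrow> a \<in> Y" for a n
    unfolding Y_def E_Suc[symmetric] by blast
  have "relatively_closed R Y"
    unfolding relatively_closed_def
  proof (intro conjI allI impI)
    show "subring Y R"
    proof (rule subringI)
      show "Y \<subseteq> carrier R" using car by (auto simp: Y_def)
      show "\<one> \<in> Y" by (rule Suc_in[of _ 0]) (simp add: acl_step_def)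
      show "\<ominus> a \<in> Y" if a: "a \<in> Y" for a
      proof -
        obtain n where "a \<in> E n" using common[OF a a] by blast
        then show ?thesis by (intro Suc_in[of _ n]) (auto simp: acl_step_def)
      qed
      fix a b assume ab: "a \<in> Y" "b \<in> Y"
      obtain n where n: "a \<in> E n" "b \<in> E n" using common[OF ab] by blast
      then have "(a, b) \<in> E n \<times> E n" by simp
      then show "a \<otimes> b \<in> Y" "a \<oplus> b \<in> Y"
        by (intro Suc_in[of _ n]; force simp: acl_step_def)+
    qed
  next
    fix n c x
    assume *: "(\<forall>i\<le>n. c i \<in> Y) \<and> c n \<noteq> \<zero> \<and> x \<in> carrier R \<and> psum R n c x = \<zero>"
    then have "\<forall>i. \<exists>m. i \<le> n \<longrightarrow> c i \<in> E m" by (auto simp: Y_def)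
    then obtain m where m: "\<And>i. i \<le> n \<Longrightarrow> c i \<in> E (m i)" by metis
    \<comment> \<open>A single stage that contains all coefficients.\<close>
    define k where "k = Max (m ` {..n})"
    have ck: "c i \<in> E k" if "i \<le> n" for i
      using m[OF that] mono[of "m i" k] that by (auto simp: k_def)
    define p where "p = map c [0..<Suc n]"
    have p: "length p - 1 = n" "\<And>i. i \<le> n \<Longrightarrow> p ! i = c i" "last p = c n" "p \<noteq> []"
      by (simp_all add: p_def nth_append del: upt_Suc) (simp_all add: nth_append)
    have "psum R n ((!) p) x = psum R n c x"
      by (rule psum_cong) (use p ck car is_cring * in auto)
    then have "x \<in> list_roots R p" using * p by (simp add: list_roots_def)
    moreover have "p \<in> lists (E k)" using ck by (auto simp: p_def)
    ultimately show "x \<in> Y" using p(4) by (intro Suc_in[of _ k]) (auto simp: acl_step_def)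
  qed
  moreover have "A \<subseteq> Y" unfolding Y_def using E_def[of 0] by auto
  ultimately have "acl R A \<subseteq> Y" by (rule acl_least)
  moreover have "|Y| \<le>o \<kappa>"
    unfolding Y_def
  proof (rule UNION_Cinfinite_bound[OF _ _ assms(3)])
    show "|UNIV :: nat set| \<le>o \<kappa>"
      using natLeq_ordLeq_cinfinite[OF assms(3)] card_of_nat ordIso_ordLeq_trans by blast
  qed (use card in auto)
  ultimately show ?thesis using card_of_mono1 ordLeq_transitive by blast
qed

section \<open>Transcendence bases along a well-order\<close>

text \<open>
  With \<open>r\<close> a well-order of the field, this is a transcendence base over the prime field, chosen greedily
  along \<open>r\<close>.
\<close>

definition acl_base :: "('a, 'm) ring_scheme \<Rightarrow> 'a rel \<Rightarrow> 'a set" where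
  "acl_base F r = {x \<in> carrier F. x \<notin> acl F (underS r x)}"

text \<open>
  By induction along \<open>r\<close>: an element that was not chosen is in the closure of its predecessors, and these
  are in the closure of the chosen elements.
\<close>

lemma acl_base_spans:
  assumes "field F" "well_order_on (carrier F) r"
  shows "acl F (acl_base F r) = carrier F"
proof
  interpret field F by fact
  let ?B = "acl_base F r"
  have B: "?B \<subseteq> carrier F" by (auto simp: acl_base_def)
  note cl = relatively_closed_acl[OF B]
  show "acl F ?B \<subseteq> carrier F" by (rule acl_least[OF relatively_closed_carrier B])
  have "wf (r - Id)" using assms(2) by (simp add: well_order_on_def)
  then have "x \<in> carrier F \<longrightarrow> x \<in> acl F ?B" for x
  proof (induction x rule: wf_induct_rule)
    case (less x)
    have "Field r = carrier F" using assms(2) well_order_on_Field by metis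
    then have "underS r x \<subseteq> acl F ?B"
      using less by (auto simp: underS_def Field_def)
    then have "acl F (underS r x) \<subseteq> acl F ?B" by (rule acl_least[OF cl])
    then show ?case using acl_extensive[of ?B F] by (auto simp: acl_base_def)
  qed
  then show "carrier F \<subseteq> acl F ?B" by blast
qed

text \<open>
  Otherwise the base would have at most \<open>\<kappa>\<close> elements, and so would its closure, the whole field.
\<close>

lemma card_acl_base:
  assumes "field F" "well_order_on (carrier F) r" "Cinfinite \<kappa>" "|carrier F| =o cardSuc \<kappa>"
  shows "cardSuc \<kappa> \<le>o |acl_base F r|"
proof (rule ccontr)
  interpret field F by fact
  let ?B = "acl_base F r"
  have B: "?B \<subseteq> carrier F" by (auto simp: acl_base_def)
  assume "\<not> cardSuc \<kappa> \<le>o |?B|"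
  then have "|?B| <o cardSuc \<kappa>"
    using assms(3) by (simp add: not_ordLeq_iff_ordLess card_of_Well_order cardSuc_Well_order)
  then have "|?B| \<le>o \<kappa>"
    using assms(3) cardSuc_ordLeq_ordLess[of \<kappa> "|?B|"] by (simp add: card_of_Card_order)
  then have "|acl F ?B| \<le>o \<kappa>" by (rule card_acl[OF B _ assms(3)])
  then have "|carrier F| \<le>o \<kappa>" by (simp add: acl_base_spans[OF assms(1,2)])
  then have "cardSuc \<kappa> \<le>o \<kappa>" using assms(4) ordIso_ordLeq_trans ordIso_symmetric by blast
  then show False using cardSuc_greater[of \<kappa>] assms(3) not_ordLess_ordLeq by blast
qed

lemma Field_Restr_card_of: "A \<subseteq> C \<Longrightarrow> Field (Restr |C| A) = A"
  using card_of_Well_order[of C] by (intro Refl_Field_Restr2) (simp_all add: order_on_defs Field_card_of)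

text \<open>
  A well-order of strictly smaller type than \<open>Restr |D| B\<close> embeds into a proper initial segment of the
  cardinal order of \<open>D\<close>, and such segments have fewer elements than \<open>D\<close>.
\<close>

lemma not_ordLess_Restr_card_of:
  assumes "A \<subseteq> C" "B \<subseteq> D" "|D| \<le>o |A|"
  shows "\<not> Restr |C| A <o Restr |D| B"
proof
  have W: "Well_order (Restr |C| A)" "Well_order (Restr |D| B)"
    by (simp_all add: Well_order_Restr card_of_Well_order)
  have Fi: "Field (Restr |C| A) = A" "Field (Restr |D| B) = B"
    using assms(1,2) by (simp_all only: Field_Restr_card_of)
  assume "Restr |C| A <o Restr |D| B"
  then obtain b where b: "b \<in> B" "Restr |C| A =o Restr (Restr |D| B) (underS (Restr |D| B) b)"
    using ordLess_iff_ordIso_Restr[OF W(2,1)] Fi by auto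
  have "|A| =o |Field (Restr (Restr |D| B) (underS (Restr |D| B) b))|"
    using card_of_cong[OF b(2)] Fi by simp
  also have "Field (Restr (Restr |D| B) (underS (Restr |D| B) b)) \<subseteq> underS (card_of D) b"
    using Field_Restr_subset by (fastforce simp: underS_def)
  then have "|Field (Restr (Restr |D| B) (underS (Restr |D| B) b))| \<le>o |underS (card_of D) b|"
    by (rule card_of_mono1)
  also have "|underS (card_of D) b| <o |D|"
    using b(1) assms(2) by (intro card_of_underS) (auto simp: card_of_Card_order Field_card_of)
  finally show False using assms(3) not_ordLess_ordLeq by blast
qed

text \<open>
  Both bases have full cardinality, so by the previous lemma neither of their orders is shorter than
  the other. The order isomorphism \<open>h\<close> between them indexes the base of \<open>G\<close> by that of \<open>F\<close> and maps
  predecessors to predecessors, which is what independence along the order needs.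
\<close>

theorem algebraically_closed_isomorphic:
  fixes F :: "('a, 'm) ring_scheme" and G :: "('b, 'n) ring_scheme" and \<kappa> :: "'k rel"
  assumes "Cinfinite \<kappa>"
    and F: "algebraically_closed F" "characteristic_zero F" "|carrier F| =o cardSuc \<kappa>"
    and G: "algebraically_closed G" "characteristic_zero G" "|carrier G| =o cardSuc \<kappa>"
  shows "F \<simeq> G"
proof -
  have fields: "field F" "field G" using F(1) G(1) by (simp_all add: algebraically_closed_def)
  define rF where "rF = |carrier F|"
  define rG where "rG = |carrier G|"
  have wo: "well_order_on (carrier F) rF" "well_order_on (carrier G) rG"
    by (simp_all add: rF_def rG_def card_of_well_order_on)
  let ?A = "acl_base F rF" and ?B = "acl_base G rG"
  have sub: "?A \<subseteq> carrier F" "?B \<subseteq> carrier G" by (auto simp: acl_base_def)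
  have "|carrier G| \<le>o |?A|" "|carrier F| \<le>o |?B|"
    using card_acl_base[OF fields(1) wo(1) assms(1) F(3)] card_acl_base[OF fields(2) wo(2) assms(1) G(3)]
      F(3) G(3) ordIso_ordLeq_trans by blast+
  then have "\<not> Restr rF ?A <o Restr rG ?B" "\<not> Restr rG ?B <o Restr rF ?A"
    unfolding rF_def rG_def
    using not_ordLess_Restr_card_of[OF sub[unfolded rF_def rG_def]]
      not_ordLess_Restr_card_of[OF sub(2,1)[unfolded rF_def rG_def]] by blast+
  moreover have W: "Well_order (Restr rF ?A)" "Well_order (Restr rG ?B)"
    by (simp_all add: rF_def rG_def Well_order_Restr card_of_Well_order)
  ultimately have "Restr rF ?A =o Restr rG ?B"
    using ordLess_or_ordLeq ordLeq_iff_ordLess_or_ordIso by metis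
  then obtain h where h: "BNF_Wellorder_Embedding.iso (Restr rF ?A) (Restr rG ?B) h" unfolding ordIso_def by blast
  have Fi: "Field (Restr rF ?A) = ?A" "Field (Restr rG ?B) = ?B"
    using sub unfolding rF_def rG_def by (simp_all only: Field_Restr_card_of)
  have bij: "bij_betw h ?A ?B" using h Fi by (simp add: BNF_Wellorder_Embedding.iso_def)
  show ?thesis
  proof (rule isomorphic_if_acl_bases[OF F(1) G(1) F(2) G(2) W(1)])
    show "acl_independent F (Restr rF ?A) id"
      unfolding acl_independent_def Fi
    proof
      fix i assume i: "i \<in> ?A"
      have "underS (Restr rF ?A) i \<subseteq> underS rF i" by (auto simp: underS_def)
      then have "acl F (underS (Restr rF ?A) i) \<subseteq> acl F (underS rF i)" by (rule acl_mono)
      then show "id i \<in> carrier F \<and> id i \<notin> acl F (id ` underS (Restr rF ?A) i)"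
        using i by (auto simp: acl_base_def)
    qed
    show "acl_independent G (Restr rF ?A) h"
      unfolding acl_independent_def Fi
    proof
      fix i assume i: "i \<in> ?A"
      have "h ` underS (Restr rF ?A) i \<subseteq> underS rG (h i)"
      proof clarify
        fix j assume j: "j \<in> underS (Restr rF ?A) i"
        then have "(h j, h i) \<in> Restr rG ?B" using iso_forward[OF _ h, of j i] by (simp add: underS_def)
        moreover have "h j \<noteq> h i" using j i bij by (auto simp: underS_def bij_betw_def inj_on_def)
        ultimately show "h j \<in> underS rG (h i)" by (simp add: underS_def)
      qed
      then have "acl G (h ` underS (Restr rF ?A) i) \<subseteq> acl G (underS rG (h i))" by (rule acl_mono)
      moreover have "h i \<in> ?B" using i bij by (auto simp: bij_betw_def)
      ultimately show "h i \<in> carrier G \<and> h i \<notin> acl G (h ` underS (Restr rF ?A) i)"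
        by (auto simp: acl_base_def)
    qed
    show "acl F (id ` Field (Restr rF ?A)) = carrier F"
      unfolding Fi using acl_base_spans[OF fields(1) wo(1)] by simp
    show "acl G (h ` Field (Restr rF ?A)) = carrier G"
      unfolding Fi using acl_base_spans[OF fields(2) wo(2)] bij by (simp add: bij_betw_def)
  qed
qed

section \<open>Homomorphic images of rings of functions\<close>

lemma (in cring) psum_rdistr:
  assumes "a \<in> carrier R" "\<And>i. i \<le> n \<Longrightarrow> c i \<in> carrier R" "x \<in> carrier R"
  shows "psum R n (\<lambda>i. a \<otimes> c i) x = a \<otimes> psum R n c x"
proof -
  have "a \<otimes> psum R n c x = (\<Oplus>i\<in>{..n}. a \<otimes> (c i \<otimes> x [^] i))"
    unfolding psum_def using assms by (intro finsum_rdistr) auto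
  also have "\<dots> = psum R n (\<lambda>i. a \<otimes> c i) x"
    unfolding psum_def using assms by (intro finsum_cong') (auto simp: m_assoc)
  finally show ?thesis by simp
qed

text \<open>
  Monic polynomials lift along a surjection to monic polynomials. A leading coefficient that is merely
  nonzero could lift to a function with zeros, and at these the degree would drop.
\<close>

lemma (in field) algebraically_closed_if_monic_roots:
  assumes "\<And>n c. \<lbrakk>0 < n; \<And>i. i \<le> n \<Longrightarrow> c i \<in> carrier R; c n = \<one>\<rbrakk> \<Longrightarrow> \<exists>y\<in>carrier R. psum R n c y = \<zero>"
  shows "algebraically_closed R"
proof (rule algebraically_closed_if_psum_roots)
  fix n :: nat and c
  assume n: "0 < n" and c: "\<And>i. i \<le> n \<Longrightarrow> c i \<in> carrier R" "c n \<noteq> \<zero>"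
  then have u: "c n \<in> Units R" by (simp add: field_Units)
  then have inv: "inv (c n) \<in> carrier R" "inv (c n) \<otimes> c n = \<one>" by simp_all
  have "\<exists>y\<in>carrier R. psum R n (\<lambda>i. inv (c n) \<otimes> c i) y = \<zero>"
    by (rule assms[OF n]) (use c inv in auto)
  then obtain y where y: "y \<in> carrier R" "inv (c n) \<otimes> psum R n c y = \<zero>"
    using psum_rdistr[OF inv(1) c(1)] by auto
  have "psum R n c y \<in> carrier R"
    using c(1) y(1) by (intro psum_in_subring carrier_is_subring)
  moreover have "inv (c n) \<noteq> \<zero>" using inv c by auto
  ultimately show "\<exists>y\<in>carrier R. psum R n c y = \<zero>" using y inv(1) integral_iff by blast
qed

lemma (in ring_hom_cring) hom_psum:
  assumes "\<And>i. i \<le> n \<Longrightarrow> c i \<in> carrier R" "x \<in> carrier R"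
  shows "h (psum R n c x) = psum S n (\<lambda>i. h (c i)) (h x)"
proof -
  have "h (psum R n c x) = (\<Oplus>\<^bsub>S\<^esub>i\<in>{..n}. h (c i \<otimes> x [^] i))"
    unfolding psum_def using assms by (subst hom_finsum) (auto simp: o_def)
  also have "\<dots> = psum S n (\<lambda>i. h (c i)) (h x)"
    unfolding psum_def using assms by (intro S.finsum_cong') auto
  finally show ?thesis .
qed

definition function_ring :: "('i \<Rightarrow> 'c::comm_ring_1) ring" where
  "function_ring = \<lparr>carrier = UNIV, monoid.mult = (\<lambda>f g i. f i * g i), monoid.one = (\<lambda>i. 1),
     ring.zero = (\<lambda>i. 0), ring.add = (\<lambda>f g i. f i + g i)\<rparr>"

lemma function_ring_simps [simp]:
  "carrier function_ring = UNIV"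
  "f \<otimes>\<^bsub>function_ring\<^esub> g = (\<lambda>i. f i * g i)"
  "f \<oplus>\<^bsub>function_ring\<^esub> g = (\<lambda>i. f i + g i)"
  "\<one>\<^bsub>function_ring\<^esub> = (\<lambda>i. 1)"
  "\<zero>\<^bsub>function_ring\<^esub> = (\<lambda>i. 0)"
  by (simp_all add: function_ring_def)

lemma cring_function_ring: "cring (function_ring :: ('i \<Rightarrow> 'c::comm_ring_1) ring)"
proof (rule cringI)
  let ?R = "function_ring :: ('i \<Rightarrow> 'c) ring"
  show "abelian_group ?R"
  proof (rule abelian_groupI)
    fix f :: "'i \<Rightarrow> 'c"
    show "\<exists>g\<in>carrier ?R. g \<oplus>\<^bsub>?R\<^esub> f = \<zero>\<^bsub>?R\<^esub>"
      by (rule bexI[of _ "\<lambda>i. - f i"]) simp_all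
  qed (simp_all add: algebra_simps)
  show "comm_monoid ?R"
    by (rule comm_monoidI) (simp_all add: algebra_simps)
qed (simp add: algebra_simps)

lemma psum_function_ring:
  fixes x :: "'i \<Rightarrow> 'c::comm_ring_1"
  shows "psum function_ring n c x i = (\<Sum>k\<le>n. c k i * x i ^ k)"
proof -
  interpret cring "function_ring :: ('i \<Rightarrow> 'c) ring" by (rule cring_function_ring)
  have pow: "(x [^]\<^bsub>function_ring\<^esub> (k::nat)) i = x i ^ k" for k
    by (induction k) (simp_all add: mult.commute)
  show ?thesis
    by (induction n) (simp_all add: psum_def pow add.commute)
qed

lemma uminus_function_ring:
  fixes f :: "'i \<Rightarrow> 'c::comm_ring_1"
  shows "\<ominus>\<^bsub>function_ring\<^esub> f = (\<lambda>i. - f i)"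
proof -
  interpret cring "function_ring :: ('i \<Rightarrow> 'c) ring" by (rule cring_function_ring)
  show ?thesis by (rule minus_equality) simp_all
qed

text \<open>
  A monic polynomial over the image lifts to a monic polynomial over the function ring. It has a root
  there, assembled from a root at each index, and the root is mapped down.
\<close>

lemma algebraically_closed_image_function_ring:
  fixes h :: "('i \<Rightarrow> 'c::alg_closed_field) \<Rightarrow> 'a"
  assumes "field F" "h \<in> ring_hom function_ring F" "range h = carrier F"
  shows "algebraically_closed F"
proof -
  interpret F: field F by fact
  interpret h: ring_hom_cring function_ring F h
    by (rule ring_hom_cringI[OF cring_function_ring F.is_cring assms(2)])
  show ?thesis
  proof (rule F.algebraically_closed_if_monic_roots)
    fix n :: nat and c
    assume n: "0 < n" and c: "\<And>i. i \<le> n \<Longrightarrow> c i \<in> carrier F" "c n = \<one>\<^bsub>F\<^esub>"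
    \<comment> \<open>An arbitrary lift of each coefficient, except that the leading one is lifted to the constant one.\<close>
    define d where "d k = (if k = n then \<lambda>i. 1 else SOME f. h f = c k)" for k
    have d: "h (d k) = c k" if "k \<le> n" for k
    proof (cases "k = n")
      case True
      then show ?thesis using c(2) h.hom_one by (simp add: d_def)
    next
      case False
      have "\<exists>f. h f = c k" using c(1)[OF that] assms(3) by (metis rangeE)
      then show ?thesis using False someI_ex[of "\<lambda>f. h f = c k"] by (simp add: d_def)
    qed
    have "\<exists>z. (\<Sum>k\<le>n. d k i * z ^ k) = 0" for i
      by (rule alg_closed) (use n in \<open>simp_all add: d_def\<close>)
    then obtain z where z: "\<And>i. (\<Sum>k\<le>n. d k i * z i ^ k) = 0" by metis
    have "psum F n c (h z) = psum F n (\<lambda>k. h (d k)) (h z)"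
      using d c(1) F.is_cring by (intro psum_cong) simp_all
    also have "\<dots> = h (psum function_ring n d z)" by (rule h.hom_psum[symmetric]) simp_all
    also have "psum function_ring n d z = (\<lambda>i. 0)" using z by (simp add: fun_eq_iff psum_function_ring)
    also have "h \<dots> = \<zero>\<^bsub>F\<^esub>" using h.hom_zero by simp
    finally show "\<exists>y\<in>carrier F. psum F n c y = \<zero>\<^bsub>F\<^esub>"
      using h.hom_closed[of z] by auto
  qed
qed

text \<open>
  Positive integers are units in the ring of functions, and a homomorphism preserves units.
\<close>

lemma characteristic_zero_image_function_ring:
  fixes h :: "('i \<Rightarrow> 'c::field_char_0) \<Rightarrow> 'a"
  assumes "field F" "h \<in> ring_hom function_ring F"
  shows "characteristic_zero F"
  unfolding characteristic_zero_def
proof (intro allI impI)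
  interpret F: field F by fact
  interpret h: ring_hom_cring function_ring F h
    by (rule ring_hom_cringI[OF cring_function_ring F.is_cring assms(2)])
  have of_nat: "add_pow F n \<one>\<^bsub>F\<^esub> = h (\<lambda>i. of_nat n)" for n :: nat
  proof (induction n)
    case 0
    then show ?case using h.hom_zero by simp
  next
    case (Suc n)
    then show ?case using h.hom_add[of "\<lambda>i. of_nat n" "\<lambda>i. 1"] h.hom_one by (simp add: add.commute)
  qed
  fix n :: nat assume n: "n > 0"
  have "h (\<lambda>i. of_nat n) \<otimes>\<^bsub>F\<^esub> h (\<lambda>i. inverse (of_nat n)) = \<one>\<^bsub>F\<^esub>"
    using h.hom_mult[of "\<lambda>i. of_nat n" "\<lambda>i. inverse (of_nat n)"] h.hom_one n by simp
  then show "add_pow F n \<one>\<^bsub>F\<^esub> \<noteq> \<zero>\<^bsub>F\<^esub>"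
    using h.hom_closed[of "\<lambda>i. inverse (of_nat n)"] by (auto simp: of_nat)
qed

lemma (in cring) exists_maximalideal_above:
  assumes J: "ideal J R" "\<one> \<notin> J"
  obtains M where "maximalideal M R" "J \<subseteq> M"
proof -
  let ?P = "{I. ideal I R \<and> J \<subseteq> I \<and> \<one> \<notin> I}"
  have "\<exists>M\<in>?P. \<forall>I\<in>?P. M \<subseteq> I \<longrightarrow> I = M"
  proof (rule subset_Zorn_nonempty)
    show "?P \<noteq> {}" using J by blast
    fix C assume C: "C \<noteq> {}" "subset.chain ?P C"
    then have "subset.chain {I. ideal I R} C" by (auto simp: subset_chain_def)
    from chain_Union_is_ideal[OF this] C(1) have "ideal (\<Union>C) R" by simp
    then show "\<Union>C \<in> ?P" using C by (auto simp: subset_chain_def)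
  qed
  then obtain M where M: "ideal M R" "J \<subseteq> M" "\<one> \<notin> M"
      and max: "\<And>I. ideal I R \<Longrightarrow> M \<subseteq> I \<Longrightarrow> \<one> \<notin> I \<Longrightarrow> I = M"
    by (smt (verit) mem_Collect_eq order_trans)
  have "maximalideal M R"
  proof (rule maximalidealI[OF M(1)])
    show "carrier R \<noteq> M" using M(3) by auto
    fix I assume I: "ideal I R" "M \<subseteq> I" "I \<subseteq> carrier R"
    show "I = M \<or> I = carrier R"
      using max[OF I(1,2)] ideal.one_imp_carrier[OF I(1)] by blast
  qed
  then show thesis using that M(2) by blast
qed

text \<open>
  The quotient by a maximal ideal, recorded through the projection alone: later arguments compute with
  values of \<open>h\<close> rather than with cosets.
\<close>

lemma (in cring) exists_field_quotient:
  assumes J: "ideal J R" "\<one> \<notin> J"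
  obtains Q and h where "field (Q :: 'a set ring)" "h \<in> ring_hom R Q" "h ` carrier R = carrier Q"
    "\<And>a. a \<in> J \<Longrightarrow> h a = \<zero>\<^bsub>Q\<^esub>"
proof -
  obtain M where M: "maximalideal M R" "J \<subseteq> M"
    by (rule exists_maximalideal_above[OF J])
  interpret M: maximalideal M R by (rule M(1))
  show thesis
  proof (rule that)
    show "field (R Quot M)" using is_cring by (rule M.quotient_is_field)
    show "(+>) M \<in> ring_hom R (R Quot M)" by (rule M.rcos_ring_hom)
    show "(+>) M ` carrier R = carrier (R Quot M)"
      by (auto simp: FactRing_def A_RCOSETS_def')
    show "M +> a = \<zero>\<^bsub>R Quot M\<^esub>" if "a \<in> J" for a
      using a_rcos_zero[OF M.is_ideal] that M(2) by (auto simp: FactRing_def)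
  qed
qed

section \<open>An algebraically closed field with two to the kappa elements\<close>

text \<open>
  A real number is determined by the rational numbers below it.
\<close>

lemma card_of_real_le: "|UNIV :: real set| \<le>o |Pow (UNIV :: nat set)|"
proof -
  define cut where "cut x = {n :: nat. real_of_rat (from_nat n) < x}" for x
  have "cut x \<noteq> cut y" if "x < y" for x y
  proof -
    obtain q where "x < real_of_rat q" "real_of_rat q < y" using of_rat_dense[OF \<open>x < y\<close>] by blast
    moreover obtain n where "from_nat n = q" by (metis from_nat_to_nat)
    ultimately have "n \<in> cut y" "n \<notin> cut x" by (auto simp: cut_def)
    then show ?thesis by blast
  qed
  then have "inj cut" by (metis injI linorder_neqE)
  then show ?thesis by (intro card_of_ordLeqI[of cut]) auto
qed

lemma card_of_Pow_eq_cexp: "|Pow A| =o ctwo ^c |A|"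
  using card_of_Pow_Func[of A] by (simp add: cexp_def ctwo_def Field_card_of)

lemma Cinfinite_ctwo_cexp: "Cinfinite \<kappa> \<Longrightarrow> Cinfinite (ctwo ^c \<kappa>)"
  by (intro Cinfinite_cexp ordLeq_refl Card_order_ctwo)

lemma card_of_complex_le:
  assumes "Cinfinite \<kappa>"
  shows "|UNIV :: complex set| \<le>o ctwo ^c \<kappa>"
proof -
  have "|Pow (UNIV :: nat set)| \<le>o ctwo ^c \<kappa>"
  proof (rule ordIso_ordLeq_trans[OF card_of_Pow_eq_cexp])
    have "|UNIV :: nat set| \<le>o \<kappa>"
      using natLeq_ordLeq_cinfinite[OF assms] card_of_nat ordIso_ordLeq_trans by blast
    then show "ctwo ^c |UNIV :: nat set| \<le>o ctwo ^c \<kappa>"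
      by (rule cexp_mono2_Cnotzero[OF _ Card_order_ctwo Cnotzero_UNIV])
  qed
  then have "|UNIV :: real set| \<le>o ctwo ^c \<kappa>"
    using card_of_real_le by (rule ordLeq_transitive[rotated])
  then have "|(UNIV :: real set) \<times> (UNIV :: real set)| \<le>o ctwo ^c \<kappa>"
    using Cinfinite_ctwo_cexp[OF assms] by (intro card_of_Times_ordLeq_infinite_Field) (auto simp: cinfinite_def)
  moreover have "|UNIV :: complex set| \<le>o |(UNIV :: real set) \<times> (UNIV :: real set)|"
    by (rule card_of_ordLeqI[of "\<lambda>z. (Re z, Im z)"]) (auto intro!: injI simp: complex_eq_iff)
  ultimately show ?thesis by (rule ordLeq_transitive[rotated])
qed

definition finite_subsets :: "'k set \<Rightarrow> 'k set set" where
  "finite_subsets A = {s. finite s \<and> s \<subseteq> A}"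

lemma card_of_finite_subsets_le:
  assumes "Cinfinite \<kappa>"
  shows "|finite_subsets (Field \<kappa>)| \<le>o \<kappa>"
proof -
  have "finite_subsets (Field \<kappa>) = set ` lists (Field \<kappa>)"
    by (auto simp: finite_subsets_def lists_eq_set image_iff dest: finite_list)
  moreover have "|lists (Field \<kappa>)| \<le>o \<kappa>"
    using assms by (intro card_of_lists_le) (simp_all add: card_of_Field_ordIso ordIso_imp_ordLeq)
  ultimately show ?thesis using ordLeq_transitive[OF card_of_image] by (simp only:)
qed

lemma card_of_functions_finite_subsets_le:
  assumes "Cinfinite \<kappa>"
  shows "|Func (finite_subsets (Field \<kappa>)) (UNIV :: complex set)| \<le>o ctwo ^c \<kappa>"
proof -
  let ?I = "finite_subsets (Field \<kappa>)"
  have ne: "?I \<noteq> {}" by (auto simp: finite_subsets_def)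
  have "|Func ?I (UNIV :: complex set)| = |UNIV :: complex set| ^c |?I|"
    by (simp add: cexp_def Field_card_of)
  also have "|UNIV :: complex set| ^c |?I| \<le>o (ctwo ^c \<kappa>) ^c |?I|"
    by (rule cexp_mono1[OF card_of_complex_le[OF assms] card_of_Card_order])
  also have "(ctwo ^c \<kappa>) ^c |?I| =o ctwo ^c \<kappa>"
    using ne assms card_of_finite_subsets_le[OF assms]
    by (intro cexp_cprod_ordLeq Card_order_ctwo)
       (simp_all add: card_of_ordIso_czero_iff_empty card_of_Card_order)
  finally show ?thesis .
qed

text \<open>
  Functions that vanish from some finite set on. Values at sets that are infinite or not contained in \<open>A\<close>
  do not count, so the quotient depends only on the values at \<open>finite_subsets A\<close>.
\<close>

definition eventually_zero :: "'k set \<Rightarrow> ('k set \<Rightarrow> 'c::zero) set" where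
  "eventually_zero A = {f. \<exists>s\<in>finite_subsets A. \<forall>t\<in>finite_subsets A. s \<subseteq> t \<longrightarrow> f t = 0}"

lemma ideal_eventually_zero:
  "ideal (eventually_zero A) (function_ring :: ('k set \<Rightarrow> 'c::comm_ring_1) ring)"
proof -
  interpret cring "function_ring :: ('k set \<Rightarrow> 'c) ring" by (rule cring_function_ring)
  have un: "s \<union> s' \<in> finite_subsets A" if "s \<in> finite_subsets A" "s' \<in> finite_subsets A" for s s'
    using that by (auto simp: finite_subsets_def)
  show ?thesis
  proof (rule idealI[OF ring_axioms])
    show "subgroup (eventually_zero A) (add_monoid (function_ring :: ('k set \<Rightarrow> 'c) ring))"
    proof (rule add.subgroupI)
      have "(\<lambda>_. 0) \<in> eventually_zero A"
        by (auto simp: eventually_zero_def finite_subsets_def)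
      then show "eventually_zero A \<noteq> {}" by blast
      fix f :: "'k set \<Rightarrow> 'c" assume f: "f \<in> eventually_zero A"
      show "\<ominus>\<^bsub>function_ring\<^esub> f \<in> eventually_zero A"
        using f by (auto simp: eventually_zero_def uminus_function_ring)
      fix g :: "'k set \<Rightarrow> 'c" assume g: "g \<in> eventually_zero A"
      obtain s where s: "s \<in> finite_subsets A" "\<And>t. t \<in> finite_subsets A \<Longrightarrow> s \<subseteq> t \<Longrightarrow> f t = 0"
        using f unfolding eventually_zero_def by blast
      obtain s' where s': "s' \<in> finite_subsets A" "\<And>t. t \<in> finite_subsets A \<Longrightarrow> s' \<subseteq> t \<Longrightarrow> g t = 0"
        using g unfolding eventually_zero_def by blast
      have "f t + g t = 0" if "t \<in> finite_subsets A" "s \<union> s' \<subseteq> t" for t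
        using s(2)[of t] s'(2)[of t] that by simp
      then show "f \<oplus>\<^bsub>function_ring\<^esub> g \<in> eventually_zero A"
        unfolding eventually_zero_def by (intro CollectI bexI[OF _ un[OF s(1) s'(1)]]) simp
    qed simp
    fix f g :: "'k set \<Rightarrow> 'c" assume "f \<in> eventually_zero A"
    then obtain s where "s \<in> finite_subsets A" "\<And>t. t \<in> finite_subsets A \<Longrightarrow> s \<subseteq> t \<Longrightarrow> f t = 0"
      unfolding eventually_zero_def by blast
    then show "g \<otimes>\<^bsub>function_ring\<^esub> f \<in> eventually_zero A" "f \<otimes>\<^bsub>function_ring\<^esub> g \<in> eventually_zero A"
      unfolding eventually_zero_def by (intro CollectI bexI[of _ s]; simp)+
  qed
qed

text \<open>
  The field is the quotient of the ring of functions by a maximal ideal above \<open>eventually_zero\<close>, moved to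
  subsets of the field of \<open>\<kappa>\<close> along a bijection. The bijection exists because the quotient has as many
  elements as the power set of \<open>\<kappa>\<close>.
\<close>

theorem algebraically_closed_field_exists:
  fixes \<kappa> :: "'k rel"
  assumes "Cinfinite \<kappa>"
  obtains F :: "'k set ring"
  where "algebraically_closed F" "characteristic_zero F" "|carrier F| =o ctwo ^c \<kappa>"
proof -
  let ?A = "Field \<kappa>"
  let ?R = "function_ring :: ('k set \<Rightarrow> complex) ring"
  let ?J = "eventually_zero ?A :: ('k set \<Rightarrow> complex) set"
  interpret R: cring ?R by (rule cring_function_ring)
  have "\<one>\<^bsub>?R\<^esub> \<notin> ?J" by (auto simp: eventually_zero_def)
  then obtain Q h where Q: "field (Q :: ('k set \<Rightarrow> complex) set ring)" "h \<in> ring_hom ?R Q"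
      "h ` carrier ?R = carrier Q" and J: "\<And>f. f \<in> ?J \<Longrightarrow> h f = \<zero>\<^bsub>Q\<^esub>"
    using R.exists_field_quotient[OF ideal_eventually_zero] by blast
  have range: "range h = carrier Q" using Q(3) by simp
  interpret Q: field Q by (rule Q(1))
  interpret h: ring_hom_cring ?R Q h
    by (rule ring_hom_cringI[OF cring_function_ring Q.is_cring Q(2)])
  have cong: "h f = h g" if "(\<lambda>t. f t - g t) \<in> ?J" for f g
  proof -
    have "h f = h (g \<oplus>\<^bsub>?R\<^esub> (\<lambda>t. f t - g t))" by simp
    also have "\<dots> = h g \<oplus>\<^bsub>Q\<^esub> h (\<lambda>t. f t - g t)" by (rule h.hom_add) simp_all
    also have "\<dots> = h g" using J[OF that] h.hom_closed[of g] by simp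
    finally show ?thesis .
  qed
  have upper: "|carrier Q| \<le>o ctwo ^c \<kappa>"
  proof -
    let ?I = "finite_subsets ?A"
    have "carrier Q \<subseteq> h ` Func ?I UNIV"
    proof
      fix a assume "a \<in> carrier Q"
      then obtain f where f: "a = h f" using range by blast
      \<comment> \<open>The value \<open>undefined\<close> is the one that \<open>Func\<close> requires off its domain.\<close>
      let ?g = "\<lambda>t. if t \<in> ?I then f t else undefined"
      have "{} \<in> ?I" by (simp add: finite_subsets_def)
      then have "h f = h ?g" by (intro cong) (auto simp: eventually_zero_def)
      moreover have "?g \<in> Func ?I UNIV" by (simp add: Func_def)
      ultimately show "a \<in> h ` Func ?I UNIV" using f by blast
    qed
    then show ?thesis
      by (rule ordLeq_transitive[OF surj_imp_ordLeq card_of_functions_finite_subsets_le[OF assms]])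
  qed
  have Pow: "|Pow ?A| =o ctwo ^c \<kappa>"
  proof (rule ordIso_transitive[OF card_of_Pow_eq_cexp])
    show "ctwo ^c |?A| =o ctwo ^c \<kappa>"
      using assms by (intro cexp_cong2 card_of_Field_ordIso Card_order_ctwo) (simp_all add: card_of_Card_order)
  qed
  have lower: "ctwo ^c \<kappa> \<le>o |carrier Q|"
  proof -
    \<comment> \<open>The code of a subset of \<open>t\<close> may depend on \<open>t\<close>: only codes at the same \<open>t\<close> are ever compared. Hence
      natural numbers suffice, although \<open>\<kappa>\<close> has uncountably many finite subsets in general.\<close>
    define e :: "'k set \<Rightarrow> 'k set \<Rightarrow> nat" where "e t = (SOME e. inj_on e (Pow t))" for t
    have e: "inj_on (e t) (Pow t)" if "finite t" for t
      using finite_imp_inj_to_nat_seg[of "Pow t"] that someI_ex[of "\<lambda>e :: 'k set \<Rightarrow> nat. inj_on e (Pow t)"]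
      by (auto simp: e_def)
    define \<phi> where "\<phi> B t = complex_of_nat (e t (B \<inter> t))" for B t
    have "h (\<phi> B) \<noteq> h (\<phi> C)" if "B \<subseteq> ?A" "C \<subseteq> ?A" "B \<noteq> C" for B C
    proof
      assume eq: "h (\<phi> B) = h (\<phi> C)"
      obtain a where a: "a \<in> ?A" "(a \<in> B) \<noteq> (a \<in> C)"
        using \<open>B \<subseteq> ?A\<close> \<open>C \<subseteq> ?A\<close> \<open>B \<noteq> C\<close> by blast
      define \<delta> where "\<delta> t = \<phi> B t - \<phi> C t" for t
      have "\<phi> B = \<delta> \<oplus>\<^bsub>?R\<^esub> \<phi> C" by (simp add: \<delta>_def)
      then have "h (\<phi> C) = h \<delta> \<oplus>\<^bsub>Q\<^esub> h (\<phi> C)" using eq h.hom_add[of \<delta> "\<phi> C"] by simp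
      then have \<delta>: "h \<delta> = \<zero>\<^bsub>Q\<^esub>"
        using Q.add.r_cancel_one'[of "h (\<phi> C)" "h \<delta>"] h.hom_closed by simp
      have "\<delta> t \<noteq> 0" if t: "finite t" "a \<in> t" for t
      proof -
        have "B \<inter> t \<noteq> C \<inter> t" using a(2) t(2) by blast
        then have "e t (B \<inter> t) \<noteq> e t (C \<inter> t)" using e[OF t(1)] by (auto simp: inj_on_def)
        then show ?thesis by (simp add: \<delta>_def \<phi>_def)
      qed
      \<comment> \<open>The pointwise inverse of \<open>\<delta>\<close> inverts it modulo the ideal, although \<open>h \<delta>\<close> is zero.\<close>
      then have "(\<lambda>t. 1 - \<delta> t * inverse (\<delta> t)) \<in> ?J"
        using a(1) unfolding eventually_zero_def
        by (intro CollectI bexI[of _ "{a}"]) (auto simp: finite_subsets_def)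
      then have "h (\<lambda>t. 1) = h (\<lambda>t. \<delta> t * inverse (\<delta> t))" by (rule cong)
      also have "\<dots> = h \<delta> \<otimes>\<^bsub>Q\<^esub> h (\<lambda>t. inverse (\<delta> t))"
        using h.hom_mult[of \<delta> "\<lambda>t. inverse (\<delta> t)"] by simp
      also have "\<dots> = \<zero>\<^bsub>Q\<^esub>" using \<delta> h.hom_closed by simp
      finally show False using h.hom_one by simp
    qed
    then have "|Pow ?A| \<le>o |carrier Q|"
      using h.hom_closed by (intro card_of_ordLeqI[of "\<lambda>B. h (\<phi> B)"]) (auto intro!: inj_onI)
    then show ?thesis by (rule ordIso_ordLeq_trans[OF ordIso_symmetric[OF Pow]])
  qed
  have card: "|carrier Q| =o ctwo ^c \<kappa>" using upper lower ordIso_iff_ordLeq by blast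
  then have "|carrier Q| =o |Pow ?A|" by (rule ordIso_transitive[OF _ ordIso_symmetric[OF Pow]])
  then obtain f where f: "bij_betw f (carrier Q) (Pow ?A)" using card_of_ordIso by blast
  then have inj: "inj_on f (carrier Q)" by (rule bij_betw_imp_inj_on)
  let ?F = "image_ring f Q"
  have F: "field ?F" by (rule Q.inj_imp_image_ring_is_field[OF inj])
  have "f \<in> ring_hom Q ?F" using inj_imp_image_ring_iso[OF inj] by (simp add: ring_iso_def)
  then have hom: "f \<circ> h \<in> ring_hom ?R ?F" by (rule ring_hom_trans[OF Q(2)])
  have car: "carrier ?F = f ` carrier Q" by (rule image_ring_carrier)
  then have surj: "range (f \<circ> h) = carrier ?F" using range by (simp only: image_comp[symmetric])
  show thesis
  proof (rule that)
    show "algebraically_closed ?F" by (rule algebraically_closed_image_function_ring[OF F hom surj])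
    show "characteristic_zero ?F" by (rule characteristic_zero_image_function_ring[OF F hom])
    have "carrier ?F = Pow ?A" using f by (simp add: car bij_betw_def)
    then show "|carrier ?F| =o ctwo ^c \<kappa>" using Pow by simp
  qed
qed

section \<open>Existence and uniqueness\<close>

theorem theorem8p2:
  fixes \<kappa> :: "'k rel"
  assumes "GCH TYPE('k)"
    and "Cinfinite \<kappa>"
  shows
    "(\<exists>F :: 'k set ring.
        algebraically_closed F \<and> characteristic_zero F \<and> |carrier F| =o cardSuc \<kappa>) \<and>
     (\<forall>(F :: ('a, 'm) ring_scheme) (G :: ('b, 'n) ring_scheme).
        algebraically_closed F \<and> characteristic_zero F \<and> |carrier F| =o cardSuc \<kappa> \<and>
        algebraically_closed G \<and> characteristic_zero G \<and> |carrier G| =o cardSuc \<kappa>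
        \<longrightarrow> F \<simeq> G) \<and>
     (\<exists>C :: 'k set ring. kappa_complex_field \<kappa> C)"
proof -
  have GCH: "ctwo ^c \<kappa> =o cardSuc \<kappa>"
    using assms unfolding GCH_def by blast
  obtain C :: "'k set ring" where C: "algebraically_closed C" "characteristic_zero C"
      "|carrier C| =o ctwo ^c \<kappa>"
    by (rule algebraically_closed_field_exists[OF assms(2)])
  have card: "|carrier C| =o cardSuc \<kappa>" using C(3) GCH by (rule ordIso_transitive)
  show ?thesis
  proof (intro conjI allI impI)
    show "\<exists>F :: 'k set ring. algebraically_closed F \<and> characteristic_zero F \<and> |carrier F| =o cardSuc \<kappa>"
      using C(1,2) card by blast
    show "\<exists>C :: 'k set ring. kappa_complex_field \<kappa> C"
      using C(1,2) card unfolding kappa_complex_field_def by blast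
  qed (elim conjE, rule algebraically_closed_isomorphic[OF assms(2)])
qed

end
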